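(* Let $(\mathcal{X},d_{\mathcal{X}})$ be a metric space with $d_{\mathcal{X}}(\cdot,\cdot)\le 1$, and let $\mathcal{A}:\mathcal{X}\to\mathcal{Y}$ be a randomized algorithm satisfying $(\alpha_0,0)$-$d_{\mathcal{X}}$-DP. Let $(x_1,\dots,x_m)$ and $(x_1',\dots,x_m')$ be two vectors in $\mathcal{X}^m$, and let $v=(d_{\mathcal{X}}(x_i,x_i'))_{i=1}^m\in\mathbb{R}^m$, with $v\neq 0$. Let $0<\delta<1$, and suppose $\alpha_0<\ln\!\left(\frac{m}{16\ln(4m/\delta)}\right)$. Then there is $\alpha$ with $$\alpha\le \|v\|_0\ln\!\left(1+\frac{\exp(\alpha_0\|v\|_1/\|v\|_0)-1}{\exp(\alpha_0\|v\|_1/\|v\|_0)+1}\left(\frac{8\sqrt{e^{\alpha_0}\ln(4\|v\|_0/\delta)}}{\sqrt m}+\frac{8e^{\alpha_0}}{m}\right)\right)$$ such that for all measurable sets $O$ of outputs, $$\Pr[\mathsf{Shuffle}(\mathcal{A}(x_1),\dots,\mathcal{A}(x_m))\in O]\le e^{\alpha}\Pr[\mathsf{Shuffle}(\mathcal{A}(x_1'),\dots,\mathcal{A}(x_m'))\in O]+\delta e^{\alpha}.$$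
   Context: $\mathcal{A}$ satisfies $(\alpha_0,0)$-$d_{\mathcal{X}}$-DP if for all $x,x'\in\mathcal{X}$ and all measurable $O\subseteq\mathcal{Y}$, $\Pr[\mathcal{A}(x)\in O]\le e^{\alpha_0 d_{\mathcal{X}}(x,x')}\Pr[\mathcal{A}(x')\in O]$. The runs $\mathcal{A}(x_1),\dots,\mathcal{A}(x_m)$ use independent randomness, and $\mathsf{Shuffle}$ applies an independent uniformly random permutation to the $m$ entries. $\|v\|_0$ is the number of nonzero coordinates of $v$ and $\|v\|_1$ is the sum of absolute values of its coordinates. *)

theory Defs
  imports "HOL-Probability.Probability" "HOL-Combinatorics.Permutations"
begin

text \<open>
  A randomized algorithm with inputs in \<open>X\<close> and outputs in the measurable space \<open>N\<close> is represented
  by its family of output distributions.  No measurability in the input is required.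
\<close>
definition randomized_algorithm :: "'x set \<Rightarrow> 'y measure \<Rightarrow> ('x \<Rightarrow> 'y measure) \<Rightarrow> bool" where
  "randomized_algorithm X N A \<longleftrightarrow> (\<forall>x\<in>X. A x \<in> space (prob_algebra N))"

definition metric_DP ::
    "'x set \<Rightarrow> ('x \<Rightarrow> 'x \<Rightarrow> real) \<Rightarrow> 'y measure \<Rightarrow> ('x \<Rightarrow> 'y measure) \<Rightarrow> real \<Rightarrow> bool" where
  "metric_DP X d N A \<alpha> \<longleftrightarrow>
     (\<forall>x\<in>X. \<forall>x'\<in>X. \<forall>S\<in>sets N. measure (A x) S \<le> exp (\<alpha> * d x x') * measure (A x') S)"

text \<open>
  Vectors of length \<open>m\<close> are functions on \<open>nat\<close> of which only the entries with index in \<open>{..<m}\<close>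
  are considered; vectors of outputs are elements of the product space over \<open>{..<m}\<close>.
\<close>
definition independent_runs ::
    "nat \<Rightarrow> ('x \<Rightarrow> 'y measure) \<Rightarrow> (nat \<Rightarrow> 'x) \<Rightarrow> (nat \<Rightarrow> 'y) measure" where
  "independent_runs m A x = PiM {..<m} (\<lambda>i. A (x i))"

text \<open>
  If \<open>M\<close> is the law of a random vector \<open>y\<close>, then \<open>Shuffle m N M\<close> is the law of \<open>y \<circ> \<pi>\<close>, where
  \<open>\<pi>\<close> is a uniformly random permutation of the indices, independent of \<open>y\<close>.
\<close>
definition Shuffle :: "nat \<Rightarrow> 'y measure \<Rightarrow> (nat \<Rightarrow> 'y) measure \<Rightarrow> (nat \<Rightarrow> 'y) measure" where
  "Shuffle m N M =
     distr (uniform_count_measure {\<pi>. \<pi> permutes {..<m}} \<Otimes>\<^sub>M M) (PiM {..<m} (\<lambda>_. N))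
       (\<lambda>(\<pi>, y). \<lambda>i\<in>{..<m}. y (\<pi> i))"

definition norm0 :: "nat \<Rightarrow> (nat \<Rightarrow> real) \<Rightarrow> nat" where
  "norm0 m v = card {i. i < m \<and> v i \<noteq> 0}"

definition norm1 :: "nat \<Rightarrow> (nat \<Rightarrow> real) \<Rightarrow> real" where
  "norm1 m v = (\<Sum>i<m. \<bar>v i\<bar>)"

lemma sets_independent_runs:
  assumes "randomized_algorithm X N A" "\<And>i. i < m \<Longrightarrow> x i \<in> X"
  shows "sets (independent_runs m A x) = sets (PiM {..<m} (\<lambda>_. N))"
  unfolding independent_runs_def using assms
  by (intro sets_PiM_cong) (auto simp: randomized_algorithm_def space_prob_algebra)

text \<open>
  The map underlying \<open>Shuffle\<close> is measurable, so \<open>distr\<close> really is the push-forward.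
\<close>
lemma measurable_Shuffle:
  fixes m :: nat
  assumes M: "sets M = sets (PiM {..<m} (\<lambda>_. N))"
  shows "(\<lambda>(\<pi>, y). \<lambda>i\<in>{..<m}. y (\<pi> i))
    \<in> uniform_count_measure {\<pi>. \<pi> permutes {..<m}} \<Otimes>\<^sub>M M \<rightarrow>\<^sub>M PiM {..<m} (\<lambda>_. N)"
proof -
  let ?P = "{\<pi>. \<pi> permutes {..<m}}"
  have fin: "finite ?P"
    by (simp add: finite_permutations)
  have "(\<lambda>(\<pi>, y). \<lambda>i\<in>{..<m}. y (\<pi> i))
      \<in> count_space ?P \<Otimes>\<^sub>M PiM {..<m} (\<lambda>_. N) \<rightarrow>\<^sub>M PiM {..<m} (\<lambda>_. N)"
  proof (rule measurable_pair_measure_countable1)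
    show "countable ?P"
      using fin by (rule countable_finite)
    fix \<pi> assume "\<pi> \<in> ?P"
    then have "\<pi> i \<in> {..<m}" if "i \<in> {..<m}" for i
      using permutes_in_image[of \<pi> "{..<m}" i] that by simp
    then have "(\<lambda>y. \<lambda>i\<in>{..<m}. y (\<pi> i)) \<in> PiM {..<m} (\<lambda>_. N) \<rightarrow>\<^sub>M PiM {..<m} (\<lambda>_. N)"
      by (intro measurable_restrict measurable_component_singleton)
    then show "(\<lambda>y. case (\<pi>, y) of (\<pi>, y) \<Rightarrow> \<lambda>i\<in>{..<m}. y (\<pi> i))
        \<in> PiM {..<m} (\<lambda>_. N) \<rightarrow>\<^sub>M PiM {..<m} (\<lambda>_. N)"
      by simp
  qed
  moreover have "sets (uniform_count_measure ?P \<Otimes>\<^sub>M M)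
      = sets (count_space ?P \<Otimes>\<^sub>M PiM {..<m} (\<lambda>_. N))"
    by (rule sets_pair_measure_cong[OF _ M]) (simp add: sets_uniform_count_measure)
  ultimately show ?thesis
    using measurable_cong_sets[OF _ refl] by blast
qed

lemma prob_space_Shuffle:
  fixes m :: nat
  assumes "prob_space M" "sets M = sets (PiM {..<m} (\<lambda>_. N))"
  shows "prob_space (Shuffle m N M)"
proof -
  let ?U = "uniform_count_measure {\<pi>. \<pi> permutes {..<m}}"
  have "prob_space ?U"
  proof (rule prob_space_uniform_count_measure)
    show "finite {\<pi>. \<pi> permutes {..<m}}"
      by (simp add: finite_permutations)
    show "{\<pi>. \<pi> permutes {..<m}} \<noteq> {}"
      using permutes_id[of "{..<m}"] by blast
  qed
  then interpret U: prob_space ?U .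
  interpret M: prob_space M by fact
  interpret pair_prob_space ?U M ..
  show ?thesis
    unfolding Shuffle_def by (intro prob_space_distr measurable_Shuffle assms)
qed

end

theory Submission
  imports Defs
begin

text \<open>
  Privacy amplification by cloning (``hiding among the clones'').  The inputs are replaced one at a
  time.  If \<open>P\<^sub>1\<close> and \<open>P\<^sub>0\<close> are the output laws for the two values of the replaced
  input and \<open>a\<close> is the privacy parameter of the pair, then both are mixtures, with weights
  \<open>e\<^sup>a / (e\<^sup>a + 1)\<close> and \<open>1 / (e\<^sup>a + 1)\<close> in either order, of two laws \<open>W\<^sub>1\<close> and
  \<open>W\<^sub>0\<close> with \<open>W\<^sub>1 + W\<^sub>0 = P\<^sub>1 + P\<^sub>0\<close>.  As distances are at most 1, each of the other
  outputs is a sample of \<open>W\<^sub>1\<close>, respectively of \<open>W\<^sub>0\<close>, with probability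
  \<open>e\<^bsup>-\<alpha>\<^sub>0\<^esup> / 2\<close> (a clone).  After shuffling only the number of samples of \<open>W\<^sub>1\<close> and of
  \<open>W\<^sub>0\<close> matters; exchanging \<open>W\<^sub>1\<close> for \<open>W\<^sub>0\<close> at the replaced position changes the
  likelihood by the ratio of these two numbers, which is close to 1 outside an event of small
  probability because the clones are numerous and evenly split.  Each replacement is charged
  \<open>\<delta> / \<parallel>v\<parallel>\<^sub>0\<close>, and the resulting exponents are added up by Jensen's inequality for the
  concave function \<open>ln (1 + \<kappa> tanh (a / 2))\<close>.
\<close>

section \<open>Concentration of the number of clones\<close>

text \<open>\<open>cosh l\<close> is the moment generating function of a uniform random sign, so
  this is the sub-Gaussian estimate for the Chernoff bound below. The difference of logarithms has
  derivative y - tanh y, nonnegative because sinh y \<le> y * cosh y.\<close>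

lemma cosh_le_exp_half_square:
  fixes x :: real
  shows "cosh x \<le> exp (x\<^sup>2 / 2)"
proof -
  have sinh_le: "sinh y \<le> y * cosh y" if "0 \<le> y" for y :: real
  proof -
    have "0 * cosh 0 - sinh 0 \<le> y * cosh y - sinh y"
    proof (rule DERIV_nonneg_imp_nondecreasing[OF that])
      fix z :: real assume "0 \<le> z" "z \<le> y"
      then show "\<exists>D. ((\<lambda>y. y * cosh y - sinh y) has_real_derivative D) (at z) \<and> 0 \<le> D"
        by (intro exI[of _ "z * sinh z"]) (auto intro!: derivative_eq_intros)
    qed
    then show ?thesis by simp
  qed
  have nonneg: "cosh y \<le> exp (y\<^sup>2 / 2)" if "0 \<le> y" for y :: real
  proof -
    have "0\<^sup>2 / 2 - ln (cosh 0) \<le> y\<^sup>2 / 2 - ln (cosh y)"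
    proof (rule DERIV_nonneg_imp_nondecreasing[OF that])
      fix z :: real assume "0 \<le> z" "z \<le> y"
      then show "\<exists>D. ((\<lambda>y. y\<^sup>2 / 2 - ln (cosh y)) has_real_derivative D) (at z) \<and> 0 \<le> D"
        using sinh_le[of z]
        by (intro exI[of _ "z - sinh z / cosh z"])
          (auto intro!: derivative_eq_intros simp: field_simps cosh_real_pos)
    qed
    then have "ln (cosh y) \<le> y\<^sup>2 / 2" by simp
    then show ?thesis by (simp add: ln_le_cancel_iff[symmetric] cosh_real_pos)
  qed
  show ?thesis using nonneg[of "\<bar>x\<bar>"] by simp
qed

lemma sum_Pow_power_card:
  fixes a b :: "'b :: comm_semiring_1"
  assumes "finite J"
  shows "(\<Sum>K\<in>Pow J. a ^ card K * b ^ card (J - K)) = (a + b) ^ card J"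
  using prod_add[OF assms, of "\<lambda>_. a" "\<lambda>_. b"] by simp

text \<open>For uniformly random \<open>K\<close>, the number 2 * card K - card J is a sum of card J
  independent signs; this is its Chernoff bound, with probabilities multiplied by 2 ^ card
  J.\<close>

lemma card_large_subsets:
  fixes L :: real
  assumes J: "finite J" "J \<noteq> {}" and L: "0 \<le> L"
  shows "real (card {K. K \<subseteq> J \<and> card J + sqrt (2 * card J * L) \<le> 2 * real (card K)})
    \<le> 2 ^ card J * exp (- L)"
proof -
  define c where "c = real (card J)"
  \<comment> \<open>The minimiser of c * l^2 / 2 - l * sqrt (2 * c * L); the minimum is - L.\<close>
  define l where "l = sqrt (2 * c * L) / c"
  have c: "c > 0" using J by (simp add: c_def card_gt_0_iff)
  have l2: "l * sqrt (2 * c * L) = 2 * L" "l\<^sup>2 * c = 2 * L"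
    using c L by (simp_all add: l_def power_divide power2_eq_square)
  let ?S = "{K. K \<subseteq> J \<and> card J + sqrt (2 * card J * L) \<le> 2 * real (card K)}"
  have "real (card ?S) \<le> (\<Sum>K\<in>?S. exp (l * (2 * real (card K) - c - sqrt (2 * c * L))))"
  proof -
    have "1 \<le> exp (l * (2 * real (card K) - c - sqrt (2 * c * L)))" if "K \<in> ?S" for K
      using that c L by (simp add: c_def l_def)
    then have "(\<Sum>K\<in>?S. 1) \<le> (\<Sum>K\<in>?S. exp (l * (2 * real (card K) - c - sqrt (2 * c * L))))"
      by (intro sum_mono) auto
    then show ?thesis by simp
  qed
  also have "\<dots> \<le> (\<Sum>K\<in>Pow J. exp (l * (2 * real (card K) - c - sqrt (2 * c * L))))"
    using J by (intro sum_mono2) auto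
  also have "\<dots> = (\<Sum>K\<in>Pow J. exp (- 2 * L) * (exp l ^ card K * exp (- l) ^ card (J - K)))"
  proof (intro sum.cong refl)
    fix K assume K: "K \<in> Pow J"
    then have cd: "card (J - K) = card J - card K" "card K \<le> card J"
      using J by (auto intro: card_Diff_subset finite_subset card_mono)
    have "l * (2 * real (card K) - c - sqrt (2 * c * L))
        = - 2 * L + (real (card K) * l + real (card (J - K)) * (- l))"
      using l2 cd by (simp add: c_def of_nat_diff algebra_simps)
    then show "exp (l * (2 * real (card K) - c - sqrt (2 * c * L)))
        = exp (- 2 * L) * (exp l ^ card K * exp (- l) ^ card (J - K))"
      by (simp only: exp_add exp_of_nat_mult)
  qed
  also have "\<dots> = exp (- 2 * L) * (2 * cosh l) ^ card J"
    unfolding sum_distrib_left[symmetric] sum_Pow_power_card[OF J(1)]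
    by (simp add: cosh_field_def add_divide_distrib)
  also have "\<dots> \<le> exp (- 2 * L) * (2 * exp (l\<^sup>2 / 2)) ^ card J"
    using cosh_le_exp_half_square[of l] by (intro mult_left_mono power_mono) auto
  also have "\<dots> = exp (- 2 * L) * (2 ^ card J * exp L)"
    using l2 by (simp add: power_mult_distrib exp_of_nat_mult[symmetric] c_def mult.commute)
  also have "\<dots> = 2 ^ card J * exp (- L)"
    by (simp add: exp_add[symmetric] mult.left_commute)
  finally show ?thesis .
qed

text \<open>Chernoff bound for a random subset that contains each element of \<open>I\<close>
  independently with probability \<open>q\<close>, using the tilt 2 powr (t - card J), which is at
  least 1 on the tail. \<open>Suc (card I)\<close> also counts the replaced position, which holds no
  clone; this costs only q / 2 in the exponent.\<close>

lemma binomial_lower_tail: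
  fixes q L :: real
  assumes I: "finite I" and q: "0 \<le> q" "q \<le> 1" and L: "1 \<le> L"
    and large: "16 * L \<le> real (Suc (card I)) * q"
  shows "(\<Sum>J\<in>{J. J \<subseteq> I \<and> real (card J) < real (Suc (card I)) * q / 2}.
      q ^ card J * (1 - q) ^ card (I - J)) \<le> exp (- L)"
proof -
  define t where "t = real (Suc (card I)) * q / 2"
  let ?S = "{J. J \<subseteq> I \<and> real (card J) < t}"
  have "(\<Sum>J\<in>?S. q ^ card J * (1 - q) ^ card (I - J))
      \<le> (\<Sum>J\<in>?S. 2 powr t * ((q / 2) ^ card J * (1 - q) ^ card (I - J)))"
  proof (intro sum_mono)
    fix J assume "J \<in> ?S"
    then have "2 powr real (card J) \<le> 2 powr t" by simp
    then have "1 \<le> 2 powr t / 2 ^ card J" by (simp add: powr_realpow)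
    from mult_right_mono[OF this, of "q ^ card J * (1 - q) ^ card (I - J)"] q
    show "q ^ card J * (1 - q) ^ card (I - J)
        \<le> 2 powr t * ((q / 2) ^ card J * (1 - q) ^ card (I - J))"
      by (simp add: power_divide)
  qed
  also have "\<dots> \<le> (\<Sum>J\<in>Pow I. 2 powr t * ((q / 2) ^ card J * (1 - q) ^ card (I - J)))"
    using I q by (intro sum_mono2) auto
  also have "\<dots> = 2 powr t * (1 - q / 2) ^ card I"
    unfolding sum_distrib_left[symmetric] sum_Pow_power_card[OF I] by simp
  also have "\<dots> \<le> 2 powr t * exp (- q / 2) ^ card I"
    using q exp_ge_add_one_self[of "- q / 2"] by (intro mult_left_mono power_mono) auto
  also have "\<dots> = exp (t * ln 2 - real (card I) * q / 2)"
    by (simp add: powr_def exp_of_nat_mult[symmetric] exp_add[symmetric])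
  also have "\<dots> \<le> exp (- L)"
  proof -
    \<comment> \<open>With t \<ge> 8 * L the exponent is at most - 11 / 36 * t + q / 2 \<le> - 22 /
      9 * L + 1 / 2, and L \<ge> 1 leaves room.\<close>
    have "t * ln 2 \<le> t * (25 / 36)"
      using ln2_le_25_over_36 q by (intro mult_left_mono) (auto simp: t_def)
    moreover have "real (card I) * q / 2 = t - q / 2" by (simp add: t_def field_simps)
    moreover have "8 * L \<le> t" using large by (simp add: t_def)
    ultimately have "t * ln 2 - real (card I) * q / 2 \<le> - L" using q L by linarith
    then show ?thesis by simp
  qed
  finally show ?thesis by (simp add: t_def)
qed

text \<open>Origin of the constants 8 and 16. If \<open>k\<close> is not large, then 16 * L \<le> M
  \<le> 2 * c forces sqrt (2 * c * L) \<le> c / 2, so c - k exceeds c / 4. The two summands of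
  \<open>\<kappa>\<close>, each times c / 4, then pay for sqrt (2 * c * L) and for the 1 in k +
  1.\<close>

lemma count_imbalance_imp_large:
  fixes L M \<kappa> c k :: real
  assumes M: "M > 0" "16 * L \<le> M" and L: "0 \<le> L" and c: "M / 2 \<le> c"
    and \<kappa>: "\<kappa> = 8 * sqrt (L / M) + 8 / M"
    and imb: "k + 1 > (1 + \<kappa>) * (c - k)"
  shows "c + sqrt (2 * c * L) \<le> 2 * k"
proof (rule ccontr)
  assume "\<not> c + sqrt (2 * c * L) \<le> 2 * k"
  then have k: "2 * k < c + sqrt (2 * c * L)" by simp
  have cpos: "0 < c" using M c by linarith
  have \<kappa>0: "0 \<le> \<kappa>" using \<kappa> M L by simp
  have "sqrt (2 * c * L) \<le> c / 2"
  proof (rule real_le_lsqrt[THEN order_trans, OF _ _ order_refl])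
    show "2 * c * L \<le> (c / 2)\<^sup>2"
      using cpos M c by (simp add: power2_eq_square field_simps)
  qed (use cpos in auto)
  then have half: "c / 4 \<le> (c - sqrt (2 * c * L)) / 2" by simp
  have r1: "sqrt (2 * c * L) \<le> 8 * sqrt (L / M) * (c / 4)"
  proof (rule real_le_lsqrt)
    have "2 * c * L = 4 * c * (M / 2) * (L / M)" using M by simp
    also have "\<dots> \<le> 4 * c * c * (L / M)" using c cpos M L by (intro mult_right_mono mult_left_mono) auto
    also have "\<dots> = (8 * sqrt (L / M) * (c / 4))\<^sup>2" using M L by (simp add: power_mult_distrib) (simp add: power2_eq_square)
    finally show "2 * c * L \<le> (8 * sqrt (L / M) * (c / 4))\<^sup>2" .
  qed (use cpos L M in auto)
  have r2: "1 \<le> 8 / M * (c / 4)" using M c by (simp add: field_simps)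
  have "sqrt (2 * c * L) + 1 \<le> \<kappa> * (c / 4)" using r1 r2 by (simp add: \<kappa> algebra_simps)
  also have "\<dots> \<le> \<kappa> * ((c - sqrt (2 * c * L)) / 2)" using half \<kappa>0 by (intro mult_left_mono)
  also have "\<dots> \<le> \<kappa> * (c - k)" using k \<kappa>0 by (intro mult_left_mono) auto
  finally show False using imb k by (simp add: algebra_simps)
qed

section \<open>Comparing the numbers of the two kinds of clones\<close>

lemma sum_Pow_depending_on_card:
  fixes F :: "nat \<Rightarrow> real"
  assumes "finite J"
  shows "(\<Sum>K\<in>Pow J. F (card K)) = (\<Sum>k\<le>card J. (card J choose k) * F k)"
proof -
  have "(\<Sum>K\<in>Pow J. F (card K)) = (\<Sum>k\<le>card J. \<Sum>K\<in>{K\<in>Pow J. card K = k}. F (card K))"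
    using assms by (intro sum.group[symmetric]) (auto intro: card_mono)
  also have "\<dots> = (\<Sum>k\<le>card J. (card J choose k) * F k)"
    using assms n_subsets[of J] by (intro sum.cong refl) (simp add: Pow_def)
  finally show ?thesis .
qed

text \<open>Both sums are expanded in the values of \<open>G\<close>. With c = card J, the
  coefficient of G (Suc k) is c choose k on the left and c choose Suc k on the right, with quotient
  (k + 1) / (c - k). Where this exceeds 1 + \<kappa>, the bound \<open>b\<close> is charged
  instead.\<close>

lemma clone_counts_fixed:
  fixes G :: "nat \<Rightarrow> real"
  assumes J: "finite J" and \<kappa>: "0 \<le> \<kappa>"
    and G: "\<And>k. k \<le> Suc (card J) \<Longrightarrow> 0 \<le> G k" "\<And>k. k \<le> Suc (card J) \<Longrightarrow> G k \<le> b"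
  shows "(\<Sum>K\<in>Pow J. G (Suc (card K))) \<le> (1 + \<kappa>) * (\<Sum>K\<in>Pow J. G (card K))
    + b * card {K. K \<subseteq> J \<and> real (card K) + 1 > (1 + \<kappa>) * (real (card J) - real (card K))}"
proof -
  define c where "c = card J"
  define good where "good k \<longleftrightarrow> real k + 1 \<le> (1 + \<kappa>) * (real c - real k)" for k
  let ?bad = "{K. K \<subseteq> J \<and> \<not> good (card K)}"
  have le: "card K \<le> c" if "K \<subseteq> J" for K using that J by (simp add: c_def card_mono)
  have "(\<Sum>K\<in>Pow J. G (Suc (card K)))
      = (\<Sum>K\<in>Pow J. if good (card K) then G (Suc (card K)) else 0)
        + (\<Sum>K\<in>Pow J. if good (card K) then 0 else G (Suc (card K)))"
    unfolding sum.distrib[symmetric] by (intro sum.cong) auto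
  also have "(\<Sum>K\<in>Pow J. if good (card K) then 0 else G (Suc (card K))) = (\<Sum>K\<in>?bad. G (Suc (card K)))"
    using J by (intro sum.mono_neutral_cong_right) auto
  also have "\<dots> \<le> (\<Sum>K\<in>?bad. b)"
    using G(2) le by (intro sum_mono) (auto simp: c_def)
  also have "\<dots> = b * card ?bad" by simp
  also have "(\<Sum>K\<in>Pow J. if good (card K) then G (Suc (card K)) else 0)
      = (\<Sum>k\<le>c. (c choose k) * (if good k then G (Suc k) else 0))"
    unfolding c_def by (rule sum_Pow_depending_on_card[OF J])
  also have "\<dots> \<le> (\<Sum>k\<le>c. (1 + \<kappa>) * ((c choose Suc k) * G (Suc k)))"
  proof (intro sum_mono)
    fix k assume "k \<in> {..c}"
    then have k: "k \<le> c" by simp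
    then have Gk: "0 \<le> G (Suc k)" using G(1) by (simp add: c_def)
    show "(c choose k) * (if good k then G (Suc k) else 0) \<le> (1 + \<kappa>) * ((c choose Suc k) * G (Suc k))"
    proof (cases "good k")
      case True
      have "Suc k * (c choose Suc k) = (c - k) * (c choose k)"
        by (metis binomial_absorb_comp binomial_absorption mult.commute)
      then have "real (Suc k) * real (c choose Suc k) = (real c - real k) * real (c choose k)"
        using k by (metis of_nat_diff of_nat_mult)
      moreover have "real (Suc k) * real (c choose k) \<le> (1 + \<kappa>) * (real c - real k) * real (c choose k)"
        using True by (intro mult_right_mono) (auto simp: good_def)
      ultimately have "real (Suc k) * real (c choose k) \<le> real (Suc k) * ((1 + \<kappa>) * real (c choose Suc k))"
        by (simp only: mult_ac)
      then have "real (c choose k) \<le> (1 + \<kappa>) * real (c choose Suc k)"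
        by (simp only: mult_le_cancel_left_pos of_nat_0_less_iff zero_less_Suc)
      from mult_right_mono[OF this Gk] True show ?thesis by simp
    qed (use Gk \<kappa> in simp)
  qed
  \<comment> \<open>Shifting the index adds the nonnegative term for k = 0; the one for k = Suc c
    has coefficient 0.\<close>
  also have "\<dots> \<le> (1 + \<kappa>) * (\<Sum>k\<le>Suc c. (c choose k) * G k)"
    unfolding sum_distrib_left[symmetric] sum.atMost_Suc_shift[of _ c]
    using \<kappa> G(1)[of 0] by (intro mult_left_mono) auto
  also have "(\<Sum>k\<le>Suc c. (c choose k) * G k) = (\<Sum>K\<in>Pow J. G (card K))"
    unfolding sum_Pow_depending_on_card[OF J] by (simp add: c_def)
  finally show ?thesis by (simp add: good_def c_def not_le)
qed

text \<open>\<open>J\<close> is the random set of clones and \<open>K\<close> the positions holding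
  the first law, uniform in \<open>J\<close>; the factor (1 - q) ^ card (I - J) of the probability
  weight is contained in the bound on \<open>T\<close>. One exp (- L) pays for too few clones, the
  other for an uneven split of many clones.\<close>

lemma clone_counts:
  fixes T :: "'i set \<Rightarrow> 'i set \<Rightarrow> real"
  assumes I: "finite I" "i \<notin> I" and q: "0 < q" "q \<le> 1" and L: "1 \<le> L"
    and M: "M = real (Suc (card I)) * q" "16 * L \<le> M"
    and \<kappa>: "\<kappa> = 8 * sqrt (L / M) + 8 / M"
    and sym: "\<And>J K K'. J \<subseteq> I \<Longrightarrow> K \<subseteq> insert i J \<Longrightarrow> K' \<subseteq> insert i J \<Longrightarrow> card K = card K' \<Longrightarrow> T J K = T J K'"
    and T: "\<And>J K. J \<subseteq> I \<Longrightarrow> K \<subseteq> insert i J \<Longrightarrow> 0 \<le> T J K"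
      "\<And>J K. J \<subseteq> I \<Longrightarrow> K \<subseteq> insert i J \<Longrightarrow> T J K \<le> (1 - q) ^ card (I - J)"
  shows "(\<Sum>J\<in>Pow I. (q / 2) ^ card J * (\<Sum>K\<in>Pow J. T J (insert i K)))
    \<le> (1 + \<kappa>) * (\<Sum>J\<in>Pow I. (q / 2) ^ card J * (\<Sum>K\<in>Pow J. T J K)) + 2 * exp (- L)"
proof -
  define bad where "bad J = {K. K \<subseteq> J \<and> real (card K) + 1 > (1 + \<kappa>) * (real (card J) - real (card K))}" for J :: "'i set"
  have Mpos: "0 < M" using M L by linarith
  have \<kappa>0: "0 \<le> \<kappa>" using Mpos L \<kappa> by simp
  have fixed: "(\<Sum>K\<in>Pow J. T J (insert i K))
      \<le> (1 + \<kappa>) * (\<Sum>K\<in>Pow J. T J K) + (1 - q) ^ card (I - J) * card (bad J)" if J: "J \<subseteq> I" for J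
  proof -
    have fin: "finite J" and i: "i \<notin> J" using J I finite_subset by auto
    \<comment> \<open>By \<open>sym\<close> the value depends on \<open>K\<close> only through its
      cardinality, so any representative will do.\<close>
    define G where "G k = T J (SOME K. K \<subseteq> insert i J \<and> card K = k)" for k
    have some: "(SOME K. K \<subseteq> insert i J \<and> card K = k) \<subseteq> insert i J \<and>
        card (SOME K. K \<subseteq> insert i J \<and> card K = k) = k" if "k \<le> Suc (card J)" for k
    proof -
      have "k \<le> card (insert i J)" using that fin i by simp
      then obtain K where "K \<subseteq> insert i J" "card K = k" by (rule obtain_subset_with_card_n)
      then show ?thesis by (intro someI[of "\<lambda>K. K \<subseteq> insert i J \<and> card K = k"]) simp
    qed
    have G: "T J K = G (card K)" if "K \<subseteq> insert i J" for K
    proof -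
      have "card K \<le> Suc (card J)" using card_mono[OF _ that] fin i by simp
      from some[OF this] show ?thesis unfolding G_def using sym[OF J that] by metis
    qed
    have "0 \<le> G k" "G k \<le> (1 - q) ^ card (I - J)" if "k \<le> Suc (card J)" for k
      using some[OF that] T[OF J] by (auto simp: G_def)
    then have "(\<Sum>K\<in>Pow J. G (Suc (card K)))
        \<le> (1 + \<kappa>) * (\<Sum>K\<in>Pow J. G (card K)) + (1 - q) ^ card (I - J) * card (bad J)"
      unfolding bad_def by (intro clone_counts_fixed fin \<kappa>0)
    moreover have "T J (insert i K) = G (Suc (card K))" if "K \<in> Pow J" for K
      using that fin i by (subst G) (auto simp: card_insert_if finite_subset)
    moreover have "T J K = G (card K)" if "K \<in> Pow J" for K using that by (intro G) auto
    ultimately show ?thesis by simp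
  qed
  \<comment> \<open>The probability that the set of clones is exactly \<open>J\<close>.\<close>
  define tot where "tot J = q ^ card J * (1 - q) ^ card (I - J)" for J
  have tot0: "0 \<le> tot J" for J using q by (simp add: tot_def)
  let ?small = "{J. J \<subseteq> I \<and> real (card J) < M / 2}"
  \<comment> \<open>With few clones all 2 ^ card J subsets may be bad; with at least M / 2 clones
    the bad ones are a fraction of at most exp (- L).\<close>
  have bad_le: "(q / 2) ^ card J * ((1 - q) ^ card (I - J) * card (bad J))
      \<le> exp (- L) * tot J + (if J \<in> ?small then tot J else 0)" if J: "J \<subseteq> I" for J
  proof -
    have fin: "finite J" using J I finite_subset by auto
    have eq: "(q / 2) ^ card J * ((1 - q) ^ card (I - J) * card (bad J)) = tot J * (card (bad J) / 2 ^ card J)"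
      by (simp add: tot_def power_divide)
    show ?thesis
    proof (cases "J \<in> ?small")
      case True
      have "card (bad J) \<le> card (Pow J)" using fin by (intro card_mono) (auto simp: bad_def)
      then have "real (card (bad J)) \<le> 2 ^ card J" using fin
        by (simp add: card_Pow)
      then have "tot J * (card (bad J) / 2 ^ card J) \<le> tot J * 1"
        using tot0 by (intro mult_left_mono) (auto simp: field_simps)
      then show ?thesis using True tot0[of J] by (simp add: eq add_increasing)
    next
      case False
      then have c: "M / 2 \<le> real (card J)" using J by simp
      have "bad J \<subseteq> {K. K \<subseteq> J \<and> card J + sqrt (2 * card J * L) \<le> 2 * real (card K)}"
        using count_imbalance_imp_large[OF Mpos M(2) _ c \<kappa>] L by (auto simp: bad_def)
      then have "card (bad J) \<le> card {K. K \<subseteq> J \<and> card J + sqrt (2 * card J * L) \<le> 2 * real (card K)}"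
        using fin by (intro card_mono) auto
      moreover have "J \<noteq> {}" using c Mpos by auto
      ultimately have "real (card (bad J)) \<le> 2 ^ card J * exp (- L)"
        using card_large_subsets[OF fin, of L] L by linarith
      then have "tot J * (card (bad J) / 2 ^ card J) \<le> tot J * exp (- L)"
        using tot0 by (intro mult_left_mono) (auto simp: field_simps)
      then show ?thesis unfolding eq if_not_P[OF False] by (simp only: mult.commute add_0_right)
    qed
  qed
  have "(\<Sum>J\<in>Pow I. (q / 2) ^ card J * (\<Sum>K\<in>Pow J. T J (insert i K)))
      \<le> (\<Sum>J\<in>Pow I. (1 + \<kappa>) * ((q / 2) ^ card J * (\<Sum>K\<in>Pow J. T J K))
        + (exp (- L) * tot J + (if J \<in> ?small then tot J else 0)))"
  proof (intro sum_mono)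
    fix J assume "J \<in> Pow I"
    then have J: "J \<subseteq> I" by simp
    have "(q / 2) ^ card J * (\<Sum>K\<in>Pow J. T J (insert i K))
       \<le> (q / 2) ^ card J * ((1 + \<kappa>) * (\<Sum>K\<in>Pow J. T J K) + (1 - q) ^ card (I - J) * card (bad J))"
      using q by (intro mult_left_mono fixed J) auto
    with bad_le[OF J] show "(q / 2) ^ card J * (\<Sum>K\<in>Pow J. T J (insert i K))
      \<le> (1 + \<kappa>) * ((q / 2) ^ card J * (\<Sum>K\<in>Pow J. T J K))
        + (exp (- L) * tot J + (if J \<in> ?small then tot J else 0))"
      by (simp add: distrib_left mult_ac)
  qed
  also have "\<dots> = (1 + \<kappa>) * (\<Sum>J\<in>Pow I. (q / 2) ^ card J * (\<Sum>K\<in>Pow J. T J K))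
      + (exp (- L) * (\<Sum>J\<in>Pow I. tot J) + (\<Sum>J\<in>?small. tot J))"
  proof -
    have "(\<Sum>J\<in>Pow I. if J \<in> ?small then tot J else 0) = (\<Sum>J\<in>?small. tot J)"
      using I by (intro sum.mono_neutral_cong_right) auto
    then show ?thesis by (simp only: sum.distrib sum_distrib_left)
  qed
  also have "(\<Sum>J\<in>Pow I. tot J) = 1"
    unfolding tot_def sum_Pow_power_card[OF I(1)] by simp
  also have "(\<Sum>J\<in>?small. tot J) \<le> exp (- L)"
    unfolding tot_def M(1) using q L M by (intro binomial_lower_tail I) auto
  finally show ?thesis by simp
qed

section \<open>Symmetric tests on a product space\<close>

text \<open>A bijection of \<open>K\<close> onto \<open>K'\<close> is glued to one of the
  complements. This will show that integrals against a symmetric test depend only on the number of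
  samples of each law.\<close>

lemma exists_permutes_image:
  assumes "finite U" "K \<subseteq> U" "K' \<subseteq> U" "card K = card K'"
  obtains p where "p permutes U" "p ` K = K'"
proof -
  have fin: "finite K" "finite K'" using assms finite_subset by auto
  obtain f where f: "bij_betw f K K'" using finite_same_card_bij[OF fin assms(4)] by blast
  have "card (U - K) = card (U - K')" using assms fin by (simp add: card_Diff_subset)
  then obtain h where h: "bij_betw h (U - K) (U - K')"
    using finite_same_card_bij[of "U - K" "U - K'"] assms(1) by auto
  define p where "p x = (if x \<in> K then f x else if x \<in> U then h x else x)" for x
  have "bij_betw p K K'" using f by (subst bij_betw_cong[of _ _ f]) (auto simp: p_def)
  moreover have "bij_betw p (U - K) (U - K')" using h by (subst bij_betw_cong[of _ _ h]) (auto simp: p_def)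
  ultimately have "bij_betw p (K \<union> (U - K)) (K' \<union> (U - K'))" by (rule bij_betw_combine) auto
  then have "bij_betw p U U" using assms by (simp add: Un_absorb1)
  then have "p permutes U" by (rule bij_imp_permutes) (use assms in \<open>auto simp: p_def\<close>)
  moreover have "p ` K = K'" using \<open>bij_betw p K K'\<close> by (simp add: bij_betw_def)
  ultimately show ?thesis by (rule that)
qed

text \<open>\<open>u\<close> and \<open>v\<close> stand for the two pure laws, \<open>p\<close> for
  the mixing weight. The two mixtures differ by (2 * p - 1) * (u - v), and if u > v then
  \<open>v\<close> is at most the smaller mixture. So \<open>\<kappa>\<close> shrinks by the factor
  2 * p - 1 while the error \<open>D\<close> does not grow.\<close>

lemma convex_combination_bound:
  fixes u v :: real
  assumes u: "u \<le> (1 + \<kappa>) * v + D" and "0 \<le> u" "0 \<le> v" "0 \<le> D" "0 \<le> \<kappa>" and p: "1 / 2 \<le> p" "p \<le> 1"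
  shows "p * u + (1 - p) * v \<le> (1 + (2 * p - 1) * \<kappa>) * (p * v + (1 - p) * u) + D"
proof -
  define t Q where "t = 2 * p - 1" and "Q = p * v + (1 - p) * u"
  have t: "0 \<le> t" "t \<le> 1" using p by (auto simp: t_def)
  have Q: "0 \<le> Q" using assms by (simp add: Q_def)
  have "t * (u - v) \<le> t * \<kappa> * Q + D"
  proof (cases "u \<le> v")
    case True
    then have "t * (u - v) \<le> 0" using t by (simp add: mult_nonneg_nonpos)
    also have "0 \<le> t * \<kappa> * Q + D" using t Q assms by simp
    finally show ?thesis .
  next
    case False
    then have "0 \<le> (1 - p) * (u - v)" using p by simp
    then have "v \<le> Q" by (simp add: Q_def algebra_simps)
    then have "\<kappa> * v \<le> \<kappa> * Q" using assms by (intro mult_left_mono)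
    then have "u - v \<le> \<kappa> * Q + D" using u by (simp add: algebra_simps)
    then have "t * (u - v) \<le> t * (\<kappa> * Q + D)" using t by (intro mult_left_mono)
    also have "\<dots> \<le> t * \<kappa> * Q + D" using t assms by (simp add: distrib_left mult_left_le_one_le)
    finally show ?thesis .
  qed
  moreover have "p * u + (1 - p) * v = Q + t * (u - v)" by (simp add: Q_def t_def algebra_simps)
  ultimately have "p * u + (1 - p) * v \<le> (1 + t * \<kappa>) * Q + D" by (simp add: algebra_simps)
  then show ?thesis by (simp add: t_def Q_def)
qed

lemma PiM_density:
  fixes f :: "'i \<Rightarrow> 'y \<Rightarrow> real"
  assumes B: "prob_space B" and I: "finite I"
    and f: "\<And>i. i \<in> I \<Longrightarrow> f i \<in> borel_measurable B" "\<And>i y. i \<in> I \<Longrightarrow> 0 \<le> f i y"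
    and prob: "\<And>i. i \<in> I \<Longrightarrow> prob_space (density B (\<lambda>y. ennreal (f i y)))"
  shows "PiM I (\<lambda>i. density B (\<lambda>y. ennreal (f i y)))
    = density (PiM I (\<lambda>_. B)) (\<lambda>y. ennreal (\<Prod>i\<in>I. f i (y i)))"
proof -
  interpret B: prob_space B by fact
  interpret P: product_prob_space "\<lambda>_. B" I ..
  \<comment> \<open>\<open>product_prob_space\<close> wants a probability measure at every index;
    the density 1 outside \<open>I\<close> gives \<open>B\<close> itself.\<close>
  define f' where "f' i = (if i \<in> I then f i else (\<lambda>_. 1))" for i
  have f': "f' i \<in> borel_measurable B" "0 \<le> f' i y" "prob_space (density B (\<lambda>y. ennreal (f' i y)))" for i y
    using f prob B by (auto simp: f'_def density_1)
  interpret D: product_prob_space "\<lambda>i. density B (\<lambda>y. ennreal (f' i y))" I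
    using f'(3) by (auto intro!: product_prob_spaceI)
  have "density (PiM I (\<lambda>_. B)) (\<lambda>y. ennreal (\<Prod>i\<in>I. f' i (y i)))
      = PiM I (\<lambda>i. density B (\<lambda>y. ennreal (f' i y)))"
  proof (rule D.PiM_eqI[OF I])
    show "sets (density (PiM I (\<lambda>_. B)) (\<lambda>y. ennreal (\<Prod>i\<in>I. f' i (y i))))
      = sets (PiM I (\<lambda>i. density B (\<lambda>y. ennreal (f' i y))))"
      by (simp cong: sets_PiM_cong)
  next
    fix S assume "\<And>i. i \<in> I \<Longrightarrow> S i \<in> sets (density B (\<lambda>y. ennreal (f' i y)))"
    then have S: "S i \<in> sets B" if "i \<in> I" for i using that by simp
    have "emeasure (density (PiM I (\<lambda>_. B)) (\<lambda>y. ennreal (\<Prod>i\<in>I. f' i (y i)))) (Pi\<^sub>E I S)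
      = (\<integral>\<^sup>+ y. ennreal (\<Prod>i\<in>I. f' i (y i)) * indicator (Pi\<^sub>E I S) y \<partial>PiM I (\<lambda>_. B))"
      using f' S I by (subst emeasure_density) (auto intro!: sets_PiM_I_finite)
    also have "\<dots> = (\<integral>\<^sup>+ y. (\<Prod>i\<in>I. ennreal (f' i (y i)) * indicator (S i) (y i)) \<partial>PiM I (\<lambda>_. B))"
    proof (intro nn_integral_cong)
      fix y assume "y \<in> space (PiM I (\<lambda>_. B))"
      then have "y \<in> extensional I" by (auto simp: space_PiM PiE_def)
      then have "(indicator (Pi\<^sub>E I S) y :: ennreal) = (\<Prod>i\<in>I. indicator (S i) (y i))"
        using I by (auto simp: indicator_def PiE_def Pi_def prod_zero_iff)
      then show "ennreal (\<Prod>i\<in>I. f' i (y i)) * indicator (Pi\<^sub>E I S) y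
          = (\<Prod>i\<in>I. ennreal (f' i (y i)) * indicator (S i) (y i))"
        using f'(2) by (simp add: prod.distrib prod_ennreal)
    qed
    also have "\<dots> = (\<Prod>i\<in>I. \<integral>\<^sup>+ y. ennreal (f' i y) * indicator (S i) y \<partial>B)"
      using f' S I by (intro P.product_nn_integral_prod) auto
    also have "\<dots> = (\<Prod>i\<in>I. emeasure (density B (\<lambda>y. ennreal (f' i y))) (S i))"
      using f' S by (intro prod.cong refl) (simp add: emeasure_density)
    finally show "emeasure (density (PiM I (\<lambda>_. B)) (\<lambda>y. ennreal (\<Prod>i\<in>I. f' i (y i)))) (Pi\<^sub>E I S)
      = (\<Prod>i\<in>I. emeasure (density B (\<lambda>y. ennreal (f' i y))) (S i))" .
  qed
  then show ?thesis by (simp add: f'_def cong: PiM_cong prod.cong)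
qed

text \<open>In the application \<open>B\<close> dominates all output laws and \<open>g y\<close> is
  the probability of accepting the unshuffled vector \<open>y\<close>; shuffling enters only through
  the symmetry of \<open>g\<close>.\<close>

locale symmetric_test = prob_space B for B :: "'y measure" +
  fixes m :: nat and g :: "(nat \<Rightarrow> 'y) \<Rightarrow> real"
  assumes g_measurable [measurable]: "g \<in> borel_measurable (PiM {..<m} (\<lambda>_. B))"
    and g_nonneg: "0 \<le> g y" and g_le_1: "g y \<le> 1"
    and g_permute: "p permutes {..<m} \<Longrightarrow> g (\<lambda>i\<in>{..<m}. y (p i)) = g y"
begin

interpretation P: product_prob_space "\<lambda>_. B" "{..<m}" ..

text \<open>For probability densities \<open>h i\<close> this is the acceptance probability under
  independent outputs. It is multilinear in \<open>h\<close>, hence also useful for the remainders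
  left after splitting off clones.\<close>

definition Phi :: "(nat \<Rightarrow> 'y \<Rightarrow> real) \<Rightarrow> real" where
  "Phi h = (\<integral>y. g y * (\<Prod>i<m. h i (y i)) \<partial>PiM {..<m} (\<lambda>_. B))"

lemma Phi_cong: "(\<And>i y. i < m \<Longrightarrow> h i y = h' i y) \<Longrightarrow> Phi h = Phi h'"
  unfolding Phi_def by simp

lemma integrable_Phi:
  assumes h: "\<And>i. i < m \<Longrightarrow> integrable B (h i)"
  shows "integrable (PiM {..<m} (\<lambda>_. B)) (\<lambda>y. g y * (\<Prod>i<m. h i (y i)))"
proof (rule Bochner_Integration.integrable_bound)
  show prod: "integrable (PiM {..<m} (\<lambda>_. B)) (\<lambda>y. \<Prod>i<m. h i (y i))"
    using h by (intro P.product_integrable_prod) auto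
  show "(\<lambda>y. g y * (\<Prod>i<m. h i (y i))) \<in> borel_measurable (PiM {..<m} (\<lambda>_. B))"
    using borel_measurable_integrable[OF prod] by measurable
  show "AE y in PiM {..<m} (\<lambda>_. B). norm (g y * (\<Prod>i<m. h i (y i))) \<le> norm (\<Prod>i<m. h i (y i))"
    using g_nonneg g_le_1 by (intro AE_I2) (simp add: abs_mult mult_left_le_one_le)
qed

lemma Phi_nonneg:
  assumes "\<And>i y. i < m \<Longrightarrow> 0 \<le> h i y"
  shows "0 \<le> Phi h"
  unfolding Phi_def using assms g_nonneg
  by (intro integral_nonneg_AE AE_I2 mult_nonneg_nonneg prod_nonneg) auto

text \<open>Supplies a factor 1 - q for each position that holds a remainder.\<close>

lemma Phi_le_prod:
  assumes h: "\<And>i. i < m \<Longrightarrow> integrable B (h i)" "\<And>i y. i < m \<Longrightarrow> 0 \<le> h i y"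
  shows "Phi h \<le> (\<Prod>i<m. \<integral>y. h i y \<partial>B)"
proof -
  have "Phi h \<le> (\<integral>y. (\<Prod>i<m. h i (y i)) \<partial>PiM {..<m} (\<lambda>_. B))"
    unfolding Phi_def
    using h g_le_1 g_nonneg
    by (intro integral_mono integrable_Phi P.product_integrable_prod mult_left_le_one_le prod_nonneg) auto
  also have "\<dots> = (\<Prod>i<m. \<integral>y. h i y \<partial>B)"
    using h by (intro P.product_integral_prod) auto
  finally show ?thesis .
qed

text \<open>Reindexing by \<open>p\<close> preserves the product of equal factors \<open>B\<close>
  and leaves \<open>g\<close> unchanged.\<close>

lemma Phi_permute:
  assumes p: "p permutes {..<m}" and h: "\<And>i. i < m \<Longrightarrow> integrable B (h i)"
  shows "Phi (\<lambda>i. h (p i)) = Phi h"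
proof -
  let ?P = "PiM {..<m} (\<lambda>_. B)" and ?s = "\<lambda>y. \<lambda>i\<in>{..<m}. y (p i)"
  have lt: "p i < m" if "i < m" for i using permutes_in_image[OF p, of i] that by simp
  have "distr ?P ?P ?s = ?P"
    using distr_PiM_reindex[of "{..<m}" "\<lambda>_. B" p "{..<m}"] permutes_inj_on[OF p] lt prob_space_axioms
    by auto
  then have "Phi (\<lambda>i. h (p i)) = (\<integral>y. g y * (\<Prod>i<m. h (p i) (y i)) \<partial>distr ?P ?P ?s)"
    unfolding Phi_def by simp
  also have "\<dots> = (\<integral>y. g (?s y) * (\<Prod>i<m. h (p i) (?s y i)) \<partial>?P)"
  proof (rule integral_distr)
    show "?s \<in> ?P \<rightarrow>\<^sub>M ?P" using lt by (intro measurable_restrict measurable_component_singleton) auto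
    show "(\<lambda>y. g y * (\<Prod>i<m. h (p i) (y i))) \<in> borel_measurable ?P"
      by (intro borel_measurable_integrable integrable_Phi h lt)
  qed
  also have "\<dots> = (\<integral>y. g y * (\<Prod>i<m. h i (y i)) \<partial>?P)"
  proof (intro Bochner_Integration.integral_cong refl)
    fix y
    have "(\<Prod>i<m. h (p i) (?s y i)) = (\<Prod>i<m. h (p i) (y (p i)))" by simp
    also have "\<dots> = (\<Prod>i<m. h i (y i))"
      using prod.permute[OF p, of "\<lambda>i. h i (y i)"] by (simp add: o_def)
    finally show "g (?s y) * (\<Prod>i<m. h (p i) (?s y i)) = g y * (\<Prod>i<m. h i (y i))"
      by (simp only: g_permute[OF p])
  qed
  finally show ?thesis unfolding Phi_def .
qed

text \<open>
  \<open>W\<close> occupies position \<open>i\<^sub>0\<close>; the other positions are split into those holding a clone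
  drawn from \<open>w1\<close> (the set \<open>K\<close>), those holding a clone drawn from \<open>w0\<close>
  (the set \<open>J - K\<close>), and those holding the remainder \<open>r\<close>.
\<close>
lemma Phi_expand:
  assumes i: "i\<^sub>0 < m" and I: "I = {..<m} - {i\<^sub>0}"
    and int: "integrable B W" "integrable B w0" "integrable B w1" "\<And>i. i \<in> I \<Longrightarrow> integrable B (r i)"
    and h: "\<And>y. h i\<^sub>0 y = W y" "\<And>i y. i \<in> I \<Longrightarrow> h i y = c * (w1 y + w0 y) + r i y"
  shows "Phi h = (\<Sum>J\<in>Pow I. c ^ card J * (\<Sum>K\<in>Pow J.
      Phi (\<lambda>i. if i = i\<^sub>0 then W else if i \<in> K then w1 else if i \<in> J then w0 else r i)))"
proof -
  let ?h = "\<lambda>J K i. if i = i\<^sub>0 then W else if i \<in> K then w1 else if i \<in> J then w0 else r i"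
  have finI: "finite I" by (simp add: I)
  have set: "{..<m} = insert i\<^sub>0 I" "i\<^sub>0 \<notin> I" using i unfolding I by auto
  have split: "(\<Prod>i<m. ?h J K i (y i))
      = W (y i\<^sub>0) * ((\<Prod>i\<in>K. w1 (y i)) * (\<Prod>i\<in>J - K. w0 (y i)) * (\<Prod>i\<in>I - J. r i (y i)))"
    if "J \<subseteq> I" "K \<subseteq> J" for J K y
  proof -
    have fin: "finite J" by (rule finite_subset[OF that(1) finI])
    have "(\<Prod>i<m. ?h J K i (y i)) = W (y i\<^sub>0) * (\<Prod>i\<in>I. ?h J K i (y i))"
      unfolding set(1) using finI set(2) by simp
    also have "(\<Prod>i\<in>I. ?h J K i (y i)) = (\<Prod>i\<in>I - J. ?h J K i (y i)) * (\<Prod>i\<in>J. ?h J K i (y i))"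
      using that finI by (intro prod.subset_diff)
    also have "(\<Prod>i\<in>J. ?h J K i (y i)) = (\<Prod>i\<in>J - K. ?h J K i (y i)) * (\<Prod>i\<in>K. ?h J K i (y i))"
      using that fin by (intro prod.subset_diff)
    also have "(\<Prod>i\<in>I - J. ?h J K i (y i)) = (\<Prod>i\<in>I - J. r i (y i))"
      using set(2) that by (intro prod.cong) auto
    also have "(\<Prod>i\<in>J - K. ?h J K i (y i)) = (\<Prod>i\<in>J - K. w0 (y i))"
      using set(2) that by (intro prod.cong) auto
    also have "(\<Prod>i\<in>K. ?h J K i (y i)) = (\<Prod>i\<in>K. w1 (y i))"
      using set(2) that by (intro prod.cong) auto
    finally show ?thesis by (simp only: mult_ac)
  qed
  have expand: "(\<Prod>i<m. h i (y i)) = (\<Sum>J\<in>Pow I. c ^ card J * (\<Sum>K\<in>Pow J. \<Prod>i<m. ?h J K i (y i)))" for y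
  proof -
    have "(\<Prod>i<m. h i (y i)) = W (y i\<^sub>0) * (\<Prod>i\<in>I. c * (w1 (y i) + w0 (y i)) + r i (y i))"
      unfolding set(1) using finI set(2) h by simp
    also have "\<dots> = (\<Sum>J\<in>Pow I. W (y i\<^sub>0) *
        ((\<Prod>i\<in>J. c * (w1 (y i) + w0 (y i))) * (\<Prod>i\<in>I - J. r i (y i))))"
      unfolding prod_add[OF finI] sum_distrib_left ..
    also have "\<dots> = (\<Sum>J\<in>Pow I. c ^ card J * (\<Sum>K\<in>Pow J. \<Prod>i<m. ?h J K i (y i)))"
    proof (intro sum.cong refl)
      fix J assume "J \<in> Pow I"
      then have J: "J \<subseteq> I" "finite J" using finI finite_subset by auto
      have "(\<Sum>K\<in>Pow J. \<Prod>i<m. ?h J K i (y i))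
          = (\<Sum>K\<in>Pow J. W (y i\<^sub>0) * (\<Prod>i\<in>I - J. r i (y i)) * ((\<Prod>i\<in>K. w1 (y i)) * (\<Prod>i\<in>J - K. w0 (y i))))"
        using split[OF J(1)] by (intro sum.cong) (auto simp: mult_ac)
      also have "\<dots> = W (y i\<^sub>0) * (\<Prod>i\<in>I - J. r i (y i)) * (\<Prod>i\<in>J. w1 (y i) + w0 (y i))"
        unfolding prod_add[OF J(2)] sum_distrib_left ..
      finally show "W (y i\<^sub>0) * ((\<Prod>i\<in>J. c * (w1 (y i) + w0 (y i))) * (\<Prod>i\<in>I - J. r i (y i)))
          = c ^ card J * (\<Sum>K\<in>Pow J. \<Prod>i<m. ?h J K i (y i))"
        by (simp add: prod.distrib mult_ac)
    qed
    finally show ?thesis .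
  qed
  have int': "integrable (PiM {..<m} (\<lambda>_. B)) (\<lambda>y. g y * (\<Prod>i<m. ?h J K i (y i)))" for J K
    using int by (intro integrable_Phi) (simp add: I)
  have "Phi h = (\<integral>y. (\<Sum>J\<in>Pow I. c ^ card J * (\<Sum>K\<in>Pow J. g y * (\<Prod>i<m. ?h J K i (y i)))) \<partial>PiM {..<m} (\<lambda>_. B))"
    unfolding Phi_def expand sum_distrib_left[of "g _"] mult.left_commute[of "g _"] ..
  also have "\<dots> = (\<Sum>J\<in>Pow I. \<integral>y. c ^ card J * (\<Sum>K\<in>Pow J. g y * (\<Prod>i<m. ?h J K i (y i))) \<partial>PiM {..<m} (\<lambda>_. B))"
    by (intro Bochner_Integration.integral_sum integrable_mult_right Bochner_Integration.integrable_sum int')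
  also have "\<dots> = (\<Sum>J\<in>Pow I. c ^ card J * (\<Sum>K\<in>Pow J. Phi (?h J K)))"
    unfolding Phi_def integral_mult_right_zero Bochner_Integration.integral_sum[OF int'] ..
  finally show ?thesis .
qed

section \<open>Replacing a single input\<close>

lemma Phi_add_scale:
  assumes i: "i\<^sub>0 < m" and int: "integrable B u" "integrable B v" "\<And>i. i < m \<Longrightarrow> integrable B (h i)"
  shows "Phi (h(i\<^sub>0 := \<lambda>y. a * u y + b * v y)) = a * Phi (h(i\<^sub>0 := u)) + b * Phi (h(i\<^sub>0 := v))"
proof -
    have split: "(\<Prod>i<m. (h(i\<^sub>0 := w)) i (y i)) = w (y i\<^sub>0) * (\<Prod>i\<in>{..<m} - {i\<^sub>0}. h i (y i))" for w :: "'y \<Rightarrow> real" and y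
    using i by (subst prod.remove[of _ i\<^sub>0]) (auto intro!: prod.cong)
  have int': "integrable (PiM {..<m} (\<lambda>_. B)) (\<lambda>y. g y * (\<Prod>i<m. (h(i\<^sub>0 := w)) i (y i)))"
    if "integrable B w" for w using that int by (intro integrable_Phi) auto
  have "Phi (h(i\<^sub>0 := \<lambda>y. a * u y + b * v y)) = (\<integral>y. a * (g y * (\<Prod>i<m. (h(i\<^sub>0 := u)) i (y i)))
     + b * (g y * (\<Prod>i<m. (h(i\<^sub>0 := v)) i (y i))) \<partial>PiM {..<m} (\<lambda>_. B))"
    unfolding Phi_def split by (simp add: algebra_simps)
  also have "\<dots> = a * Phi (h(i\<^sub>0 := u)) + b * Phi (h(i\<^sub>0 := v))"
    using int'[OF int(1)] int'[OF int(2)] unfolding Phi_def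
    by (subst Bochner_Integration.integral_add) auto
  finally show ?thesis .
qed

text \<open>Subtracting q / 2 * (w1 + w0) from every other density leaves nonnegative remainders of
  mass 1 - q. Expanding over the clones then puts both sides into the form treated by
  \<open>clone_counts\<close>.\<close>

lemma clone_replacement:
  assumes i: "i\<^sub>0 < m"
    and w: "integrable B w0" "integrable B w1" "\<And>y. 0 \<le> w0 y" "\<And>y. 0 \<le> w1 y"
      "(\<integral>y. w0 y \<partial>B) = 1" "(\<integral>y. w1 y \<partial>B) = 1"
    and f: "\<And>i. i < m \<Longrightarrow> integrable B (f i)" "\<And>i. i < m \<Longrightarrow> (\<integral>y. f i y \<partial>B) = 1"
    and clone: "\<And>i y. i < m \<Longrightarrow> i \<noteq> i\<^sub>0 \<Longrightarrow> q / 2 * (w1 y + w0 y) \<le> f i y"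
    and q: "0 < q" "q \<le> 1" and L: "1 \<le> L" and M: "M = real m * q" "16 * L \<le> M"
    and \<kappa>: "\<kappa> = 8 * sqrt (L / M) + 8 / M"
  shows "Phi (f(i\<^sub>0 := w1)) \<le> (1 + \<kappa>) * Phi (f(i\<^sub>0 := w0)) + 2 * exp (- L)"
proof -
  define I where "I = {..<m} - {i\<^sub>0}"
  define r where "r i = (\<lambda>y. f i y - q / 2 * (w1 y + w0 y))" for i
  \<comment> \<open>\<open>K\<close> may contain \<open>i\<^sub>0\<close>: having \<open>w1\<close>
    instead of \<open>w0\<close> there is the passage from \<open>K\<close> to
    \<open>insert i\<^sub>0 K\<close>, so one family describes both sides.\<close>
  define h where "h J K = (\<lambda>i. if i \<in> K then w1 else if i \<in> insert i\<^sub>0 J then w0 else r i)" for J K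
  define T where "T J K = Phi (h J K)" for J K
  have I: "finite I" "i\<^sub>0 \<notin> I" "Suc (card I) = m" using i by (auto simp: I_def card_Diff_singleton)
  have r: "integrable B (r i)" "0 \<le> r i y" "(\<integral>y. r i y \<partial>B) = 1 - q" if "i \<in> I" for i y
    using that w f clone[of i y] by (auto simp: I_def r_def)
  have h: "integrable B (h J K i)" "0 \<le> h J K i y" "i < m \<Longrightarrow> (\<integral>y. h J K i y \<partial>B) \<le> (if i \<in> I - J then 1 - q else 1)"
    if "J \<subseteq> I" "K \<subseteq> insert i\<^sub>0 J" "i < m" for J K i y
  proof -
    show "integrable B (h J K i)" "0 \<le> h J K i y"
      using that w r[of i] by (auto simp: h_def I_def)
    show "(\<integral>y. h J K i y \<partial>B) \<le> (if i \<in> I - J then 1 - q else 1)"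
      using that w r[of i] q by (auto simp: h_def I_def)
  qed
  have expand: "Phi (f(i\<^sub>0 := W)) = (\<Sum>J\<in>Pow I. (q / 2) ^ card J * (\<Sum>K\<in>Pow J.
      Phi (\<lambda>i. if i = i\<^sub>0 then W else if i \<in> K then w1 else if i \<in> J then w0 else r i)))"
    if "integrable B W" for W
    by (rule Phi_expand) (use i w that r I_def in \<open>auto simp: r_def\<close>)
  have "Phi (f(i\<^sub>0 := w1)) = (\<Sum>J\<in>Pow I. (q / 2) ^ card J * (\<Sum>K\<in>Pow J. T J (insert i\<^sub>0 K)))"
    unfolding expand[OF w(2)] T_def h_def
    by (intro sum.cong arg_cong2[where f = "(*)"] arg_cong[where f = Phi] refl ext) auto
  moreover have "Phi (f(i\<^sub>0 := w0)) = (\<Sum>J\<in>Pow I. (q / 2) ^ card J * (\<Sum>K\<in>Pow J. T J K))"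
    unfolding expand[OF w(1)] T_def h_def using I(2)
    by (intro sum.cong arg_cong2[where f = "(*)"] arg_cong[where f = Phi] refl ext) auto
  moreover have "(\<Sum>J\<in>Pow I. (q / 2) ^ card J * (\<Sum>K\<in>Pow J. T J (insert i\<^sub>0 K)))
    \<le> (1 + \<kappa>) * (\<Sum>J\<in>Pow I. (q / 2) ^ card J * (\<Sum>K\<in>Pow J. T J K)) + 2 * exp (- L)"
  proof (rule clone_counts[OF I(1,2) q L _ M(2) \<kappa>])
    show "M = real (Suc (card I)) * q" by (simp only: I(3) M)
  next
    fix J K K' assume J: "J \<subseteq> I" and K: "K \<subseteq> insert i\<^sub>0 J" "K' \<subseteq> insert i\<^sub>0 J" "card K = card K'"
    have "finite (insert i\<^sub>0 J)" using finite_subset[OF J I(1)] by simp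
    then obtain p where p: "p permutes insert i\<^sub>0 J" "p ` K = K'"
      using exists_permutes_image K by metis
    have "insert i\<^sub>0 J \<subseteq> {..<m}" using J i by (auto simp: I_def)
    with p(1) have pm: "p permutes {..<m}" by (rule permutes_subset)
    \<comment> \<open>\<open>p\<close> moves only positions in \<open>insert i\<^sub>0 J\<close>,
      hence the remainders, which may differ from position to position, stay in place.\<close>
    have "h J K i = h J K' (p i)" for i
    proof -
      have "p i \<in> K' \<longleftrightarrow> i \<in> K"
        using inj_image_mem_iff[OF permutes_inj[OF p(1)], of i K] by (simp only: p(2))
      moreover have "p i \<in> insert i\<^sub>0 J \<longleftrightarrow> i \<in> insert i\<^sub>0 J" by (rule permutes_in_image[OF p(1)])
      moreover have "p i = i" if "i \<notin> insert i\<^sub>0 J" using permutes_not_in[OF p(1) that] .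
      ultimately show ?thesis unfolding h_def by presburger
    qed
    then have "T J K = Phi (\<lambda>i. h J K' (p i))" unfolding T_def by presburger
    also have "\<dots> = T J K'" unfolding T_def using J K by (intro Phi_permute pm h(1))
    finally show "T J K = T J K'" .
  next
    fix J K assume J: "J \<subseteq> I" and K: "K \<subseteq> insert i\<^sub>0 J"
    show "0 \<le> T J K" unfolding T_def using h[OF J K] by (intro Phi_nonneg)
    have "T J K \<le> (\<Prod>i<m. \<integral>y. h J K i y \<partial>B)" unfolding T_def using h[OF J K] by (intro Phi_le_prod)
    also have "\<dots> \<le> (\<Prod>i<m. if i \<in> I - J then 1 - q else 1)"
      using h[OF J K] by (intro prod_mono) (auto intro!: integral_nonneg_AE)
    also have "\<dots> = (\<Prod>i\<in>I - J. 1 - q)"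
      by (intro prod.mono_neutral_cong_right) (auto simp: I_def)
    finally show "T J K \<le> (1 - q) ^ card (I - J)" by simp
  qed
  ultimately show ?thesis by simp
qed

text \<open>The mixture decomposition reduces the pair \<open>p0\<close>, \<open>p1\<close> to
  \<open>clone_replacement\<close> for the pair \<open>w0\<close>, \<open>w1\<close>. With e = exp
  a, the weight e / (e + 1) makes the factor of \<open>\<kappa>\<close> equal to 2 * e / (e + 1) - 1
  = tanh (a / 2).\<close>

lemma clone_step:
  assumes i: "i\<^sub>0 < m"
    and p: "integrable B p0" "integrable B p1" "\<And>y. 0 \<le> p0 y" "\<And>y. 0 \<le> p1 y"
      "(\<integral>y. p0 y \<partial>B) = 1" "(\<integral>y. p1 y \<partial>B) = 1"
    and f: "\<And>i. i < m \<Longrightarrow> integrable B (f i)" "\<And>i. i < m \<Longrightarrow> (\<integral>y. f i y \<partial>B) = 1"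
    and a: "0 \<le> a" "\<And>y. p1 y \<le> exp a * p0 y" "\<And>y. p0 y \<le> exp a * p1 y"
    and clone: "\<And>i y. i < m \<Longrightarrow> i \<noteq> i\<^sub>0 \<Longrightarrow> q * p0 y \<le> f i y"
      "\<And>i y. i < m \<Longrightarrow> i \<noteq> i\<^sub>0 \<Longrightarrow> q * p1 y \<le> f i y"
    and q: "0 < q" "q \<le> 1" and L: "1 \<le> L" and M: "M = real m * q" "16 * L \<le> M"
    and \<kappa>: "\<kappa> = 8 * sqrt (L / M) + 8 / M"
  shows "Phi (f(i\<^sub>0 := p1)) \<le> (1 + (exp a - 1) / (exp a + 1) * \<kappa>) * Phi (f(i\<^sub>0 := p0)) + 2 * exp (- L)"
\<comment> \<open>The decomposition divides by exp a - 1; for a = 0 the two densities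
  coincide.\<close>
proof (cases "a = 0")
  case True
  then have "p1 = p0" using a by (intro ext antisym) auto
  then show ?thesis using True by simp
next
  case False
  define e where "e = exp a"
  have e: "1 < e" using a(1) False by (simp add: e_def)
  \<comment> \<open>Solution of p1 = (e * w1 + w0) / (e + 1) and p0 = (e * w0 + w1) / (e + 1). The
    two privacy inequalities say exactly that \<open>w0\<close> and \<open>w1\<close> are
    nonnegative.\<close>
  define w1 where "w1 y = (e * p1 y - p0 y) / (e - 1)" for y
  define w0 where "w0 y = (e * p0 y - p1 y) / (e - 1)" for y
  have w: "integrable B w0" "integrable B w1" "\<And>y. 0 \<le> w0 y" "\<And>y. 0 \<le> w1 y"
    "(\<integral>y. w0 y \<partial>B) = 1" "(\<integral>y. w1 y \<partial>B) = 1"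
    unfolding w0_def w1_def using p a(2,3) e by (auto simp: e_def)
  have sum: "w1 y + w0 y = p1 y + p0 y" for y
  proof -
    have "w1 y + w0 y = (e - 1) * (p1 y + p0 y) / (e - 1)"
      by (simp add: w0_def w1_def add_divide_distrib[symmetric] algebra_simps)
    then show ?thesis using e by simp
  qed
  have p1: "p1 = (\<lambda>y. e / (e + 1) * w1 y + (1 - e / (e + 1)) * w0 y)"
    and p0: "p0 = (\<lambda>y. e / (e + 1) * w0 y + (1 - e / (e + 1)) * w1 y)"
  proof -
    have e1: "e + 1 \<noteq> 0" "e - 1 \<noteq> 0" using e by auto
    have c: "1 - e / (e + 1) = 1 / (e + 1)" using e1 by (simp add: field_simps)
    have "e * w1 y + w0 y = (e - 1) * ((e + 1) * p1 y) / (e - 1)"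
      "e * w0 y + w1 y = (e - 1) * ((e + 1) * p0 y) / (e - 1)" for y
      unfolding w0_def w1_def times_divide_eq_right add_divide_distrib[symmetric]
      by (simp_all add: algebra_simps)
    then have "(e + 1) * p1 y = e * w1 y + w0 y" "(e + 1) * p0 y = e * w0 y + w1 y" for y
      using e1 by simp_all
    then show "p1 = (\<lambda>y. e / (e + 1) * w1 y + (1 - e / (e + 1)) * w0 y)"
      "p0 = (\<lambda>y. e / (e + 1) * w0 y + (1 - e / (e + 1)) * w1 y)"
      unfolding c fun_eq_iff using e1 by (simp_all add: add_divide_distrib[symmetric] eq_divide_eq mult.commute)
  qed
  have "0 < M" using M L by linarith
  then have \<kappa>0: "0 \<le> \<kappa>" using \<kappa> L by simp
  \<comment> \<open>Since w1 + w0 = p1 + p0, this is the average of the two hypotheses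
    \<open>clone\<close>.\<close>
  have "q / 2 * (w1 y + w0 y) \<le> f i y" if "i < m" "i \<noteq> i\<^sub>0" for i y
    unfolding sum using clone[OF that, of y] by (simp add: distrib_left)
  then have main: "Phi (f(i\<^sub>0 := w1)) \<le> (1 + \<kappa>) * Phi (f(i\<^sub>0 := w0)) + 2 * exp (- L)"
    by (intro clone_replacement[OF i w f _ q L M \<kappa>])
  have f0: "0 \<le> f i y" if "i < m" "i \<noteq> i\<^sub>0" for i y
    using clone(1)[OF that, of y] q p(3)[of y] by (meson mult_nonneg_nonneg less_imp_le order_trans)
  have nonneg: "0 \<le> Phi (f(i\<^sub>0 := w1))" "0 \<le> Phi (f(i\<^sub>0 := w0))"
    using f0 w by (auto intro!: Phi_nonneg)
  have "e / (e + 1) * Phi (f(i\<^sub>0 := w1)) + (1 - e / (e + 1)) * Phi (f(i\<^sub>0 := w0))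
     \<le> (1 + (2 * (e / (e + 1)) - 1) * \<kappa>) * (e / (e + 1) * Phi (f(i\<^sub>0 := w0)) + (1 - e / (e + 1)) * Phi (f(i\<^sub>0 := w1)))
        + 2 * exp (- L)"
    by (rule convex_combination_bound[OF main nonneg]) (use \<kappa>0 e in \<open>auto simp: field_simps\<close>)
  also have "e / (e + 1) * Phi (f(i\<^sub>0 := w1)) + (1 - e / (e + 1)) * Phi (f(i\<^sub>0 := w0)) = Phi (f(i\<^sub>0 := p1))"
    by (subst p1, rule Phi_add_scale[symmetric, OF i w(2,1) f(1)])
  also have "e / (e + 1) * Phi (f(i\<^sub>0 := w0)) + (1 - e / (e + 1)) * Phi (f(i\<^sub>0 := w1)) = Phi (f(i\<^sub>0 := p0))"
    by (subst p0, rule Phi_add_scale[symmetric, OF i w(1,2) f(1)])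
  also have "2 * (e / (e + 1)) - 1 = (exp a - 1) / (exp a + 1)"
    using e by (simp add: e_def[symmetric] divide_simps)
  finally show ?thesis .
qed

lemma Phi_eq_integral_PiM:
  assumes f: "\<And>i. i < m \<Longrightarrow> f i \<in> borel_measurable B" "\<And>i y. i < m \<Longrightarrow> 0 \<le> f i y"
    and prob: "\<And>i. i < m \<Longrightarrow> prob_space (density B (\<lambda>y. ennreal (f i y)))"
  shows "Phi f = (\<integral>y. g y \<partial>PiM {..<m} (\<lambda>i. density B (\<lambda>y. ennreal (f i y))))"
proof -
  have "PiM {..<m} (\<lambda>i. density B (\<lambda>y. ennreal (f i y)))
      = density (PiM {..<m} (\<lambda>_. B)) (\<lambda>y. ennreal (\<Prod>i<m. f i (y i)))"
    using f prob by (intro PiM_density prob_space_axioms) auto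
  moreover have "(\<integral>y. g y \<partial>density (PiM {..<m} (\<lambda>_. B)) (\<lambda>y. ennreal (\<Prod>i<m. f i (y i))))
      = (\<integral>y. (\<Prod>i<m. f i (y i)) *\<^sub>R g y \<partial>PiM {..<m} (\<lambda>_. B))"
  proof (rule integral_density[OF g_measurable])
    have "(\<lambda>y. f i (y i)) \<in> borel_measurable (PiM {..<m} (\<lambda>_. B))" if "i \<in> {..<m}" for i
      using measurable_compose[OF measurable_component_singleton[OF that]] f(1) that by auto
    then show "(\<lambda>y. \<Prod>i<m. f i (y i)) \<in> borel_measurable (PiM {..<m} (\<lambda>_. B))"
      by (intro borel_measurable_prod)
    show "AE y in PiM {..<m} (\<lambda>_. B). 0 \<le> (\<Prod>i<m. f i (y i))"
      using f by (intro AE_I2 prod_nonneg) auto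
  qed
  ultimately show ?thesis by (simp add: Phi_def mult.commute)
qed

end

section \<open>Densities of the output laws and the law of the shuffled outputs\<close>

lemma (in prob_space) integral_density_eq_1:
  fixes f :: "'a \<Rightarrow> real"
  assumes f: "f \<in> borel_measurable M" "\<And>y. 0 \<le> f y"
    and prob: "prob_space (density M (\<lambda>y. ennreal (f y)))"
  shows "(\<integral>y. f y \<partial>M) = 1"
proof -
  interpret D: prob_space "density M (\<lambda>y. ennreal (f y))" by (rule prob)
  have "(\<integral>y. f y \<partial>M) = (\<integral>y. 1 \<partial>density M (\<lambda>y. ennreal (f y)))"
    using f by (subst integral_density) auto
  also have "\<dots> = 1" using D.prob_space by simp
  finally show ?thesis .
qed

text \<open>Any one of the laws can serve as \<open>B\<close>, since privacy makes the others
  absolutely continuous with respect to it. Privacy on all measurable sets gives the inequality of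
  densities almost everywhere for each pair; finiteness of \<open>F\<close> leaves one common null
  set, where the densities are changed to 0 so that the inequality holds at every point.\<close>

lemma metric_DP_densities:
  assumes alg: "randomized_algorithm X N A" and dp: "metric_DP X d N A \<alpha>"
    and F: "finite F" "F \<subseteq> X" "F \<noteq> {}"
  obtains B f where "prob_space B" "sets B = sets N"
    "\<And>x. x \<in> F \<Longrightarrow> integrable B (f x)" "\<And>x y. 0 \<le> f x y"
    "\<And>x. x \<in> F \<Longrightarrow> A x = density B (\<lambda>y. ennreal (f x y))"
    "\<And>x x' y. x \<in> F \<Longrightarrow> x' \<in> F \<Longrightarrow> f x y \<le> exp (\<alpha> * d x x') * f x' y"
proof -
  obtain b where b: "b \<in> F" using F by blast
  define B where "B = A b"
  have prob: "prob_space (A x)" and sets: "sets (A x) = sets N" if "x \<in> F" for x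
    using alg F that by (auto simp: randomized_algorithm_def space_prob_algebra)
  interpret B: prob_space B unfolding B_def by (rule prob[OF b])
  have setsB [measurable_cong]: "sets B = sets N" unfolding B_def by (rule sets[OF b])
  have le: "measure (A x) S \<le> exp (\<alpha> * d x x') * measure (A x') S"
    if "x \<in> F" "x' \<in> F" "S \<in> sets N" for x x' S
    using dp F that by (auto simp: metric_DP_def)
  \<comment> \<open>\<open>enn2real\<close> turns the value infinity into 0; for inputs in
    \<open>F\<close> this happens only on a null set.\<close>
  define f0 where "f0 x y = enn2real (RN_deriv B (A x) y)" for x y
  have meas: "f0 x \<in> borel_measurable B" for x unfolding f0_def by measurable
  have dens: "density B (\<lambda>y. ennreal (f0 x y)) = A x" if x: "x \<in> F" for x
  proof -
    interpret Ax: prob_space "A x" by (rule prob[OF x])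
    have ac: "absolutely_continuous B (A x)"
      unfolding absolutely_continuous_def
    proof
      fix S assume S: "S \<in> null_sets B"
      then have SN: "S \<in> sets N" using setsB by auto
      have "measure (A b) S = 0" using S by (auto simp: B_def measure_def)
      with le[OF x b SN] have "measure (A x) S = 0" by (simp add: measure_le_0_iff)
      then show "S \<in> null_sets (A x)" using SN sets[OF x] by (simp add: null_sets_def Ax.emeasure_eq_measure)
    qed
    have sx: "sets (A x) = sets B" using sets[OF x] setsB by simp
    have "AE y in B. RN_deriv B (A x) y \<noteq> \<infinity>"
      by (rule B.RN_deriv_finite[OF Ax.sigma_finite_measure_axioms ac sx])
    then have "AE y in B. RN_deriv B (A x) y = ennreal (f0 x y)"
      by eventually_elim (simp add: f0_def less_top)
    then have "density B (RN_deriv B (A x)) = density B (\<lambda>y. ennreal (f0 x y))"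
      using meas by (intro density_cong) auto
    then show ?thesis using B.density_RN_deriv[OF ac sx] by simp
  qed
  have int: "integrable B (f0 x)" if x: "x \<in> F" for x
  proof (rule integrableI_nonneg[OF meas])
    show "AE y in B. 0 \<le> f0 x y" by (simp add: f0_def)
    have "(\<integral>\<^sup>+ y. ennreal (f0 x y) \<partial>B) = emeasure (density B (\<lambda>y. ennreal (f0 x y))) (space B)"
      using meas by (subst emeasure_density) (auto intro!: nn_integral_cong)
    also have "\<dots> = emeasure (A x) (space (A x))"
      unfolding dens[OF x] using sets[OF x] setsB sets_eq_imp_space_eq by metis
    finally show "(\<integral>\<^sup>+ y. ennreal (f0 x y) \<partial>B) < \<infinity>"
      using prob_space.emeasure_space_1[OF prob[OF x]] by simp
  qed
  have set_int: "(LINT y:S|B. f0 x y) = measure (A x) S" if "x \<in> F" "S \<in> sets B" for x S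
  proof -
    have "emeasure (A x) S = (\<integral>\<^sup>+ y. ennreal (indicator S y * f0 x y) \<partial>B)"
      unfolding dens[OF that(1), symmetric] using meas that
      by (subst emeasure_density) (auto intro!: nn_integral_cong simp: indicator_def)
    moreover have "0 \<le> indicator S y * f0 x y" for y by (simp add: f0_def)
    ultimately show ?thesis
      using meas that(2) unfolding set_lebesgue_integral_def measure_def
      by (subst integral_eq_nn_integral) auto
  qed
  have "AE y in B. f0 x y \<le> exp (\<alpha> * d x x') * f0 x' y" if x: "x \<in> F" "x' \<in> F" for x x'
  proof -
    have "AE y in B. 0 \<le> exp (\<alpha> * d x x') * f0 x' y - f0 x y"
    proof (rule B.density_nonneg)
      show "integrable B (\<lambda>y. exp (\<alpha> * d x x') * f0 x' y - f0 x y)" using int x by auto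
      fix S assume S: "S \<in> sets B"
      have si: "set_integrable B S (f0 z)" if "z \<in> F" for z
        unfolding set_integrable_def by (rule integrable_mult_indicator[OF S int[OF that]])
      have "(LINT y:S|B. exp (\<alpha> * d x x') * f0 x' y - f0 x y)
          = exp (\<alpha> * d x x') * measure (A x') S - measure (A x) S"
        unfolding set_int[OF x(1) S, symmetric] set_int[OF x(2) S, symmetric] using si x
        by (subst set_integral_diff) auto
      then show "0 \<le> (LINT y:S|B. exp (\<alpha> * d x x') * f0 x' y - f0 x y)"
        using le[OF x] S setsB by simp
    qed
    then show ?thesis by simp
  qed
  then have "AE y in B. \<forall>x\<in>F. \<forall>x'\<in>F. f0 x y \<le> exp (\<alpha> * d x x') * f0 x' y"
    using F by (simp add: AE_finite_all)
  define G where "G = {y \<in> space B. \<forall>x\<in>F. \<forall>x'\<in>F. f0 x y \<le> exp (\<alpha> * d x x') * f0 x' y}"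
  define f where "f x y = indicator G y * f0 x y" for x y
  have G: "G \<in> sets B" unfolding G_def using F meas by measurable
  have ae: "AE y in B. f x y = f0 x y" for x
    using \<open>AE y in B. \<forall>x\<in>F. \<forall>x'\<in>F. f0 x y \<le> exp (\<alpha> * d x x') * f0 x' y\<close> AE_space
    by eventually_elim (simp add: f_def G_def)
  show ?thesis
  proof (rule that[of B f])
    show "prob_space B" by (rule B.prob_space_axioms)
    show "sets B = sets N" by (rule setsB)
    show "integrable B (f x)" if "x \<in> F" for x
      unfolding f_def using integrable_mult_indicator[OF G int[OF that]] by simp
    show "0 \<le> f x y" for x y by (simp add: f_def f0_def)
    show "A x = density B (\<lambda>y. ennreal (f x y))" if "x \<in> F" for x
    proof -
      have "density B (\<lambda>y. ennreal (f0 x y)) = density B (\<lambda>y. ennreal (f x y))"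
        using ae[of x] meas G by (intro density_cong) (auto simp: f_def)
      then show ?thesis using dens[OF that] by simp
    qed
    show "f x y \<le> exp (\<alpha> * d x x') * f x' y" if "x \<in> F" "x' \<in> F" for x x' y
      using that by (auto simp: f_def G_def indicator_def)
  qed
qed

text \<open>Conditional probability, given the unshuffled vector \<open>y\<close>, that the shuffled
  one lies in \<open>S\<close>.\<close>

definition shuffle_test :: "nat \<Rightarrow> (nat \<Rightarrow> 'y) set \<Rightarrow> (nat \<Rightarrow> 'y) \<Rightarrow> real" where
  "shuffle_test m S y =
     (\<Sum>p | p permutes {..<m}. indicator S (\<lambda>i\<in>{..<m}. y (p i))) / real (card {p. p permutes {..<m}})"

lemma shuffle_test_bounds: "0 \<le> shuffle_test m S y" "shuffle_test m S y \<le> 1"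
proof -
  show "0 \<le> shuffle_test m S y" unfolding shuffle_test_def by (intro divide_nonneg_nonneg sum_nonneg) auto
  have "(\<Sum>p | p permutes {..<m}. indicator S (\<lambda>i\<in>{..<m}. y (p i))) \<le> (\<Sum>p | p permutes {..<m}. 1 :: real)"
    by (intro sum_mono) (auto simp: indicator_def)
  then show "shuffle_test m S y \<le> 1" by (cases "card {p. p permutes {..<m}} = 0") (simp_all add: shuffle_test_def divide_le_eq_1)
qed

text \<open>Left composition with \<open>q\<close> is a bijection of the permutations, so it only
  reorders the sum.\<close>

lemma shuffle_test_permute:
  assumes q: "q permutes {..<m}"
  shows "shuffle_test m S (\<lambda>i\<in>{..<m}. y (q i)) = shuffle_test m S y"
proof -
  have "(\<Sum>p | p permutes {..<m}. indicator S (\<lambda>i\<in>{..<m}. y (p i)) :: real)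
      = (\<Sum>p | p permutes {..<m}. indicator S (\<lambda>i\<in>{..<m}. y ((q \<circ> p) i)))"
    by (rule setum_permutations_compose_left[OF q])
  also have "\<dots> = (\<Sum>p | p permutes {..<m}. indicator S (\<lambda>i\<in>{..<m}. (\<lambda>i\<in>{..<m}. y (q i)) (p i)))"
  proof (intro sum.cong refl)
    fix p assume "p \<in> {p. p permutes {..<m}}"
    \<comment> \<open>As \<open>p\<close> maps the index set into itself, the inner restriction is
      never evaluated outside its domain.\<close>
    then have "p i < m" if "i < m" for i using that permutes_in_image[of p "{..<m}" i] by simp
    then have "(\<lambda>i\<in>{..<m}. y ((q \<circ> p) i)) = (\<lambda>i\<in>{..<m}. (\<lambda>i\<in>{..<m}. y (q i)) (p i))"
      by (auto simp: restrict_def)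
    then show "(indicator S (\<lambda>i\<in>{..<m}. y ((q \<circ> p) i)) :: real)
      = indicator S (\<lambda>i\<in>{..<m}. (\<lambda>i\<in>{..<m}. y (q i)) (p i))" by simp
  qed
  finally show ?thesis by (simp add: shuffle_test_def)
qed

lemma measurable_permute_indices:
  fixes m :: nat
  assumes "p permutes {..<m}"
  shows "(\<lambda>y. \<lambda>i\<in>{..<m}. y (p i)) \<in> PiM {..<m} (\<lambda>_. N) \<rightarrow>\<^sub>M PiM {..<m} (\<lambda>_. N)"
  using permutes_in_image[OF assms] by (intro measurable_restrict measurable_component_singleton) simp

lemma shuffle_test_measurable:
  assumes S: "S \<in> sets (PiM {..<m} (\<lambda>_. N))"
  shows "shuffle_test m S \<in> borel_measurable (PiM {..<m} (\<lambda>_. N))"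
proof -
  have "(\<lambda>y. indicator S (\<lambda>i\<in>{..<m}. y (p i)) :: real) \<in> borel_measurable (PiM {..<m} (\<lambda>_. N))"
    if "p permutes {..<m}" for p
    using measurable_compose[OF measurable_permute_indices[OF that] borel_measurable_indicator[OF S]] .
  then show ?thesis unfolding shuffle_test_def by (intro borel_measurable_divide borel_measurable_sum) auto
qed

text \<open>Fubini's theorem, followed by exchanging the finite sum over permutations with the
  integral, turns shuffling into a symmetric test on the unshuffled vector.\<close>

lemma measure_Shuffle:
  fixes m :: nat
  assumes M: "prob_space M" "sets M = sets (PiM {..<m} (\<lambda>_. N))"
    and S: "S \<in> sets (PiM {..<m} (\<lambda>_. N))"
  shows "measure (Shuffle m N M) S = (\<integral>y. shuffle_test m S y \<partial>M)"
proof -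
  let ?P = "{p. p permutes {..<m}}" and ?s = "\<lambda>(p, y). \<lambda>i\<in>{..<m}. y (p i)"
  let ?U = "uniform_count_measure ?P"
  have "finite ?P" by (simp add: finite_permutations)
  moreover have "?P \<noteq> {}" using permutes_id[of "{..<m}"] by blast
  ultimately have P: "finite ?P" "?P \<noteq> {}" by auto
  interpret U: prob_space ?U by (rule prob_space_uniform_count_measure[OF P])
  interpret M: prob_space M by fact
  interpret UM: pair_prob_space ?U M ..
  note meas = measurable_Shuffle[OF M(2)]
  have int: "integrable (?U \<Otimes>\<^sub>M M) (\<lambda>z. indicator S (?s z) :: real)"
    by (rule UM.P.integrable_const_bound[where B = 1])
      (use measurable_compose[OF meas borel_measurable_indicator[OF S]] in \<open>auto simp: indicator_def\<close>)
  have "measure (Shuffle m N M) S = (\<integral>z. indicator S z \<partial>Shuffle m N M)"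
    using S by (simp add: Shuffle_def)
  also have "\<dots> = (\<integral>z. indicator S (?s z) \<partial>(?U \<Otimes>\<^sub>M M))"
    unfolding Shuffle_def by (rule integral_distr[OF meas borel_measurable_indicator[OF S]])
  also have "\<dots> = (\<integral>p. \<integral>y. indicator S (?s (p, y)) \<partial>M \<partial>?U)"
    by (rule UM.integral_fst'[OF int, symmetric])
  also have "\<dots> = (\<Sum>p\<in>?P. \<integral>y. indicator S (?s (p, y)) \<partial>M) / real (card ?P)"
    by (rule integral_uniform_count_measure[OF P(1)])
  also have "(\<Sum>p\<in>?P. \<integral>y. indicator S (?s (p, y)) \<partial>M) = (\<integral>y. (\<Sum>p\<in>?P. indicator S (?s (p, y)) :: real) \<partial>M)"
  proof (rule Bochner_Integration.integral_sum[symmetric])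
    fix p assume "p \<in> ?P"
    then have "(\<lambda>y. \<lambda>i\<in>{..<m}. y (p i)) \<in> M \<rightarrow>\<^sub>M PiM {..<m} (\<lambda>_. N)"
      using measurable_permute_indices measurable_cong_sets[OF M(2) refl] by blast
    from measurable_compose[OF this borel_measurable_indicator[OF S]]
    show "integrable M (\<lambda>y. indicator S (?s (p, y)) :: real)"
      by (intro M.integrable_const_bound[where B = 1]) (auto simp: indicator_def)
  qed
  finally show ?thesis by (simp add: shuffle_test_def)
qed

section \<open>Composition over the replaced inputs\<close>

text \<open>Unrolling multiplies each error \<open>\<eta> j\<close> by the exponentials of the
  earlier steps only; enlarging this to the full product yields an additive term of the form
  \<delta> * exp \<alpha>.\<close>

lemma iterated_exp_bound:
  fixes u \<epsilon> \<eta> :: "nat \<Rightarrow> real"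
  assumes step: "\<And>j. j < m \<Longrightarrow> u j \<le> exp (\<epsilon> j) * u (Suc j) + \<eta> j"
    and nonneg: "\<And>j. j < m \<Longrightarrow> 0 \<le> \<epsilon> j" "\<And>j. j < m \<Longrightarrow> 0 \<le> \<eta> j"
  shows "u 0 \<le> exp (\<Sum>j<m. \<epsilon> j) * (u m + (\<Sum>j<m. \<eta> j))"
  using assms
proof (induction m)
  case (Suc m)
  let ?E = "\<Sum>j<m. \<epsilon> j" and ?H = "\<Sum>j<m. \<eta> j"
  have H: "0 \<le> \<eta> m + ?H" using Suc.prems(3) by (intro add_nonneg_nonneg sum_nonneg) auto
  have "u 0 \<le> exp ?E * (u m + ?H)" using Suc by simp
  also have "\<dots> \<le> exp ?E * (exp (\<epsilon> m) * u (Suc m) + 1 * (\<eta> m + ?H))"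
    using Suc.prems(1)[of m] by (intro mult_left_mono) auto
  \<comment> \<open>The factor 1 of the errors is enlarged so that the new exponential can be pulled
    out.\<close>
  also have "\<dots> \<le> exp ?E * (exp (\<epsilon> m) * u (Suc m) + exp (\<epsilon> m) * (\<eta> m + ?H))"
    using Suc.prems(2)[of m] H by (intro mult_left_mono add_left_mono mult_right_mono) auto
  finally show ?case by (simp add: exp_add algebra_simps)
qed simp

text \<open>The fraction is tanh (a / 2), concave for a \<ge> 0 by its second derivative; an
  increasing concave function of a concave function is concave.\<close>

lemma concave_ln_tanh:
  fixes \<kappa> :: real
  assumes \<kappa>: "0 \<le> \<kappa>"
  shows "concave_on {0..} (\<lambda>a. ln (1 + (exp a - 1) / (exp a + 1) * \<kappa>))"
proof -
  define t :: "real \<Rightarrow> real" where "t a = (exp a - 1) / (exp a + 1)" for a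
  have e1: "exp a + 1 \<noteq> (0::real)" for a :: real by (smt (verit) exp_gt_zero)
  have t0: "0 \<le> t a" if "0 \<le> a" for a using that by (simp add: t_def)
  have "concave_on {0..} t"
  proof (rule f''_le0_imp_concave)
    show "(t has_real_derivative 2 * exp a / (exp a + 1)\<^sup>2) (at a)" for a
      unfolding t_def using e1[of a]
      by (auto intro!: derivative_eq_intros simp: power2_eq_square field_simps)
    show "((\<lambda>a. 2 * exp a / (exp a + 1)\<^sup>2) has_real_derivative 2 * exp a * (1 - exp a) / (exp a + 1) ^ 3) (at a)" for a :: real
      using e1[of a]
      by (auto intro!: derivative_eq_intros simp: power2_eq_square power3_eq_cube divide_simps) (simp add: algebra_simps)
    show "2 * exp a * (1 - exp a) / (exp a + 1) ^ 3 \<le> 0" if "a \<in> {0..}" for a :: real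
      using that by (intro divide_nonpos_nonneg mult_nonneg_nonpos) auto
  qed auto
  show ?thesis unfolding t_def[symmetric]
  unfolding concave_on_iff
  proof (intro conjI ballI allI impI)
    fix x y u s :: real
    assume xy: "x \<in> {0..}" "y \<in> {0..}" and s': "0 \<le> u" "0 \<le> s" "u + s = 1"
    then have u: "u = 1 - s" and s: "0 \<le> s" "s \<le> 1" by auto
    have "(1 - s) * ln (1 + t x * \<kappa>) + s * ln (1 + t y * \<kappa>)
       \<le> ln ((1 - s) * (1 + t x * \<kappa>) + s * (1 + t y * \<kappa>))"
      using concave_onD[OF ln_concave, of s "1 + t x * \<kappa>" "1 + t y * \<kappa>"] s xy t0 \<kappa>
      by (simp add: add_pos_nonneg)
    also have "\<dots> = ln (1 + ((1 - s) * t x + s * t y) * \<kappa>)" by (simp add: algebra_simps)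
    also have "\<dots> \<le> ln (1 + t ((1 - s) * x + s * y) * \<kappa>)"
    proof -
      have "(1 - s) * t x + s * t y \<le> t ((1 - s) * x + s * y)"
        using concave_onD[OF \<open>concave_on {0..} t\<close>, of s x y] s xy by simp
      then have "((1 - s) * t x + s * t y) * \<kappa> \<le> t ((1 - s) * x + s * y) * \<kappa>"
        using \<kappa> by (intro mult_right_mono)
      moreover have "0 \<le> ((1 - s) * t x + s * t y) * \<kappa>" using s xy t0 \<kappa> by simp
      ultimately show ?thesis by simp
    qed
    finally show "u * ln (1 + t x * \<kappa>) + s * ln (1 + t y * \<kappa>)
      \<le> ln (1 + t (u *\<^sub>R x + s *\<^sub>R y) * \<kappa>)" by (simp add: u)
  qed auto
qed

lemma sum_ln_tanh_le:
  fixes a :: "nat \<Rightarrow> real"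
  assumes V: "finite V" "V \<noteq> {}" and a: "\<And>i. i \<in> V \<Longrightarrow> 0 \<le> a i" and \<kappa>: "0 \<le> \<kappa>"
    and s: "s = (\<Sum>i\<in>V. a i) / card V"
  shows "(\<Sum>i\<in>V. ln (1 + (exp (a i) - 1) / (exp (a i) + 1) * \<kappa>))
    \<le> real (card V) * ln (1 + (exp s - 1) / (exp s + 1) * \<kappa>)"
proof -
  define \<phi> where "\<phi> b = ln (1 + (exp b - 1) / (exp b + 1) * \<kappa>)" for b
  have c: "0 < real (card V)" using V by (simp add: card_gt_0_iff)
  have "(\<Sum>i\<in>V. (1 / card V) * \<phi> (a i)) \<le> \<phi> (\<Sum>i\<in>V. (1 / card V) *\<^sub>R a i)"
    using concave_ln_tanh[OF \<kappa>] V a c unfolding \<phi>_def[symmetric]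
    by (intro concave_on_sum[where C = "{0..}"]) auto
  also have "(\<Sum>i\<in>V. (1 / card V) *\<^sub>R a i) = s"
    by (simp add: s sum_divide_distrib)
  finally have "(\<Sum>i\<in>V. \<phi> (a i)) / card V \<le> \<phi> s" by (simp add: sum_divide_distrib)
  then show ?thesis using c by (simp add: \<phi>_def divide_le_eq mult.commute)
qed

section \<open>Choice of the constants and hybrid argument\<close>

theorem theorem4p3:
  fixes X :: "'x set" and d :: "'x \<Rightarrow> 'x \<Rightarrow> real"
    and N :: "'y measure" and A :: "'x \<Rightarrow> 'y measure"
    and \<alpha>\<^sub>0 \<delta> :: real and m :: nat
    and x x' :: "nat \<Rightarrow> 'x" and v :: "nat \<Rightarrow> real"
  assumes "Metric_space X d"
    and "\<And>a b. a \<in> X \<Longrightarrow> b \<in> X \<Longrightarrow> d a b \<le> 1"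
    and "randomized_algorithm X N A"
    and "metric_DP X d N A \<alpha>\<^sub>0"
    and "\<And>i. i < m \<Longrightarrow> x i \<in> X"
    and "\<And>i. i < m \<Longrightarrow> x' i \<in> X"
    and "\<And>i. i < m \<Longrightarrow> v i = d (x i) (x' i)"
    and "\<exists>i<m. v i \<noteq> 0"
    and "0 < \<delta>" and "\<delta> < 1"
    and "\<alpha>\<^sub>0 < ln (real m / (16 * ln (4 * real m / \<delta>)))"
  shows "\<exists>\<alpha>::real.
    \<alpha> \<le> real (norm0 m v) *
        ln (1 + (exp (\<alpha>\<^sub>0 * norm1 m v / real (norm0 m v)) - 1)
                / (exp (\<alpha>\<^sub>0 * norm1 m v / real (norm0 m v)) + 1)
              * (8 * sqrt (exp \<alpha>\<^sub>0 * ln (4 * real (norm0 m v) / \<delta>)) / sqrt (real m)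
                 + 8 * exp \<alpha>\<^sub>0 / real m)) \<and>
    (\<forall>S \<in> sets (PiM {..<m} (\<lambda>_. N)).
       measure (Shuffle m N (independent_runs m A x)) S
         \<le> exp \<alpha> * measure (Shuffle m N (independent_runs m A x')) S + \<delta> * exp \<alpha>)"
proof -
  note dle = assms(2) and alg = assms(3) and dp = assms(4) and xX = assms(5,6) and v = assms(7)
    and \<delta> = assms(9,10)
  interpret X: Metric_space X d by fact
  define V where "V = {i. i < m \<and> v i \<noteq> 0}"
  define k where "k = norm0 m v"
  have V: "finite V" "V \<noteq> {}" "V \<subseteq> {..<m}" using assms(8) by (auto simp: V_def)
  have k: "k = card V" "0 < k" "k \<le> m"
    using V card_mono[of "{..<m}" V] by (auto simp: k_def norm0_def V_def[symmetric] card_gt_0_iff)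
  have v0: "0 \<le> v i" if "i < m" for i using v[OF that] by simp
  have prob: "prob_space (A z)" "sets (A z) = sets N" if "z \<in> X" for z
    using alg that by (auto simp: randomized_algorithm_def space_prob_algebra)
  \<comment> \<open>Privacy on the whole space gives 1 \<le> exp
    (\<open>\<alpha>\<^sub>0 * v i\<close>), and some \<open>v i\<close> is positive.\<close>
  have \<alpha>0: "0 \<le> \<alpha>\<^sub>0"
  proof -
    obtain i where i: "i < m" "v i \<noteq> 0" using assms(8) by blast
    have "measure (A z) (space N) = 1" if "z \<in> X" for z
      using prob_space.prob_space[OF prob(1)[OF that]] sets_eq_imp_space_eq[OF prob(2)[OF that]] by simp
    then have "1 \<le> exp (\<alpha>\<^sub>0 * v i)"
      using dp xX i v[OF i(1)] unfolding metric_DP_def by (metis mult.right_neutral sets.top)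
    then have "0 \<le> \<alpha>\<^sub>0 * v i" by simp
    then show ?thesis using i v0[OF i(1)] by (simp add: zero_le_mult_iff)
  qed
  \<comment> \<open>\<open>q\<close> bounds the ratio of any two densities from below, as distances
    are at most 1. \<open>M\<close> exceeds the expected number of clones, (m - 1) * q, by
    \<open>q\<close>. \<open>L\<close> makes the failure term 2 * exp (- L) of one replacement equal
    to \<delta> / (2 * k).\<close>
  define q L M \<kappa> where "q = exp (- \<alpha>\<^sub>0)" and "L = ln (4 * real k / \<delta>)" and "M = real m * q"
    and "\<kappa> = 8 * sqrt (L / M) + 8 / M"
  have q: "0 < q" "q \<le> 1" using \<alpha>0 by (auto simp: q_def)
  have four: "4 \<le> 4 * real k / \<delta>" using \<delta> k by (simp add: le_divide_eq)
  have L: "1 \<le> L"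
  proof -
    have "exp 1 \<le> 4 * real k / \<delta>" using exp_le four by linarith
    then show ?thesis using four unfolding L_def by (subst ln_ge_iff) auto
  qed
  have L_le: "L \<le> ln (4 * real m / \<delta>)"
    unfolding L_def using k \<delta> four by (subst ln_le_cancel_iff) (auto simp: divide_right_mono)
  \<comment> \<open>The upper bound on \<open>\<alpha>\<^sub>0\<close> enters here; its logarithm
    dominates \<open>L\<close> because k \<le> m. Positivity of the quotient comes first, since only
    then does exp invert ln.\<close>
  have M: "16 * L \<le> M"
  proof -
    have pos: "0 < real m / (16 * ln (4 * real m / \<delta>))" using L L_le k by simp
    have "exp \<alpha>\<^sub>0 < real m / (16 * ln (4 * real m / \<delta>))"
      using assms(11) pos by (metis exp_less_cancel_iff exp_ln)
    then have "16 * ln (4 * real m / \<delta>) * exp \<alpha>\<^sub>0 < real m"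
      using L L_le by (simp add: field_simps)
    then have "16 * ln (4 * real m / \<delta>) < M"
      by (simp add: M_def q_def exp_minus field_simps)
    then show ?thesis using L_le by linarith
  qed
  have Mpos: "0 < M" using M L by linarith
  have \<kappa>0: "0 \<le> \<kappa>" using Mpos L by (simp add: \<kappa>_def)
  have \<kappa>: "8 * sqrt (exp \<alpha>\<^sub>0 * L) / sqrt (real m) + 8 * exp \<alpha>\<^sub>0 / real m = \<kappa>"
    unfolding \<kappa>_def M_def q_def by (simp add: exp_minus real_sqrt_divide field_simps)
  have tail: "2 * exp (- L) \<le> \<delta> / k"
    unfolding L_def using four \<delta> k by (simp add: exp_minus field_simps)
  \<comment> \<open>The exponent paid for replacing input \<open>i\<close>; it is 0 when
    \<open>v i\<close> is 0.\<close>
  define \<epsilon> where "\<epsilon> i = ln (1 + (exp (\<alpha>\<^sub>0 * v i) - 1) / (exp (\<alpha>\<^sub>0 * v i) + 1) * \<kappa>)" for i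
  have t0: "0 \<le> (exp (\<alpha>\<^sub>0 * v i) - 1) / (exp (\<alpha>\<^sub>0 * v i) + 1) * \<kappa>" if "i < m" for i
    using \<alpha>0 v0[OF that] \<kappa>0 by (intro mult_nonneg_nonneg divide_nonneg_nonneg) (auto intro: add_nonneg_nonneg)
  have \<epsilon>: "0 \<le> \<epsilon> i" "exp (\<epsilon> i) = 1 + (exp (\<alpha>\<^sub>0 * v i) - 1) / (exp (\<alpha>\<^sub>0 * v i) + 1) * \<kappa>" if "i < m" for i
    using t0[OF that] by (auto simp: \<epsilon>_def)
  \<comment> \<open>Only finitely many inputs occur, so their laws admit a common choice of
    densities.\<close>
  define F where "F = x ` {..<m} \<union> x' ` {..<m}"
  have F: "finite F" "F \<subseteq> X" "F \<noteq> {}" "\<And>i. i < m \<Longrightarrow> x i \<in> F" "\<And>i. i < m \<Longrightarrow> x' i \<in> F"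
    using xX k by (auto simp: F_def lessThan_empty_iff)
  obtain B f where B: "prob_space B" "sets B = sets N"
    and f: "\<And>z. z \<in> F \<Longrightarrow> integrable B (f z)" "\<And>z y. 0 \<le> f z y"
      "\<And>z. z \<in> F \<Longrightarrow> A z = density B (\<lambda>y. ennreal (f z y))"
      "\<And>z z' y. z \<in> F \<Longrightarrow> z' \<in> F \<Longrightarrow> f z y \<le> exp (\<alpha>\<^sub>0 * d z z') * f z' y"
    using metric_DP_densities[OF alg dp F(1-3)] by blast
  interpret B: prob_space B by (rule B)
  have f1: "(\<integral>y. f z y \<partial>B) = 1" if "z \<in> F" for z
    using f(2) f(1,3)[OF that] prob(1)[of z] F(2) that
    by (intro B.integral_density_eq_1 borel_measurable_integrable) auto
  have clone: "q * f z y \<le> f z' y" if "z \<in> F" "z' \<in> F" for z z' y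
  proof -
    have "d z z' \<le> 1" using dle F(2) that by blast
    then have "\<alpha>\<^sub>0 * d z z' \<le> \<alpha>\<^sub>0" using \<alpha>0 by (simp add: mult_left_le)
    then have "exp (\<alpha>\<^sub>0 * d z z') * f z' y \<le> exp \<alpha>\<^sub>0 * f z' y" using f(2) by (intro mult_right_mono) auto
    then have "f z y \<le> exp \<alpha>\<^sub>0 * f z' y" using f(4)[OF that, of y] by linarith
    then show ?thesis by (simp add: q_def exp_minus field_simps)
  qed
  have main: "measure (Shuffle m N (independent_runs m A x)) S
      \<le> exp (\<Sum>i<m. \<epsilon> i) * (measure (Shuffle m N (independent_runs m A x')) S + \<delta>)"
    if S: "S \<in> sets (PiM {..<m} (\<lambda>_. N))" for S
  proof -
    have setsP: "sets (PiM {..<m} (\<lambda>_. B)) = sets (PiM {..<m} (\<lambda>_. N))"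
      using B by (intro sets_PiM_cong) auto
    interpret symmetric_test B m "shuffle_test m S"
    proof
      show "shuffle_test m S \<in> borel_measurable (PiM {..<m} (\<lambda>_. B))"
        using shuffle_test_measurable[OF S] measurable_cong_sets[OF setsP refl] by blast
    qed (simp_all add: shuffle_test_bounds shuffle_test_permute)
    have runs: "measure (Shuffle m N (independent_runs m A z)) S = Phi (\<lambda>i. f (z i))"
      if z: "\<And>i. i < m \<Longrightarrow> z i \<in> F" for z
    proof -
      have zX: "z i \<in> X" if "i < m" for i using z[OF that] F(2) by blast
      have eq: "independent_runs m A z = PiM {..<m} (\<lambda>i. density B (\<lambda>y. ennreal (f (z i) y)))"
        unfolding independent_runs_def using f(3) z by (intro PiM_cong) auto
      have pr: "prob_space (density B (\<lambda>y. ennreal (f (z i) y)))" if "i < m" for i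
        using prob(1)[OF zX[OF that]] f(3)[OF z[OF that]] by simp
      have "prob_space (independent_runs m A z)"
        unfolding eq using pr by (intro prob_space_PiM) auto
      moreover have "sets (independent_runs m A z) = sets (PiM {..<m} (\<lambda>_. N))"
        by (rule sets_independent_runs[OF alg zX])
      ultimately have "measure (Shuffle m N (independent_runs m A z)) S
          = (\<integral>y. shuffle_test m S y \<partial>independent_runs m A z)"
        by (rule measure_Shuffle[OF _ _ S])
      also have "\<dots> = Phi (\<lambda>i. f (z i))"
        unfolding eq using f(1,2) z pr
        by (intro Phi_eq_integral_PiM[symmetric] borel_measurable_integrable) auto
      finally show ?thesis .
    qed
    \<comment> \<open>Hybrid vectors in which the first \<open>j\<close> inputs are already
      replaced: \<open>h 0\<close> belongs to \<open>x\<close> and \<open>h m\<close> to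
      \<open>x'\<close>.\<close>
    define h where "h j i = f (if i < j then x' i else x i)" for i j :: nat
    have hF: "(if i < j then x' i else x i) \<in> F" if "i < m" for i j :: nat using F that by simp
    \<comment> \<open>Where \<open>v j\<close> is 0 the inputs agree and nothing is charged, so
      \<delta> / k is charged exactly \<open>k\<close> times.\<close>
    have step: "Phi (h j) \<le> exp (\<epsilon> j) * Phi (h (Suc j)) + (if v j \<noteq> 0 then \<delta> / k else 0)" if j: "j < m" for j
    proof -
      have upd: "h j = (h j)(j := f (x j))" "h (Suc j) = (h j)(j := f (x' j))"
        by (auto simp: h_def fun_eq_iff)
      show ?thesis
      proof (cases "v j = 0")
        case True
        then have "x j = x' j" using v[OF j] xX[OF j] by simp
        then have "h (Suc j) = h j" using upd by simp
        then show ?thesis using True by (simp add: \<epsilon>_def)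
      next
        case False
        have dj: "d (x' j) (x j) = v j" "d (x j) (x' j) = v j" using v[OF j] by (auto simp: X.commute)
        have "Phi ((h j)(j := f (x j)))
            \<le> (1 + (exp (\<alpha>\<^sub>0 * v j) - 1) / (exp (\<alpha>\<^sub>0 * v j) + 1) * \<kappa>) * Phi ((h j)(j := f (x' j))) + 2 * exp (- L)"
        proof (rule clone_step[OF j])
          show "f (x j) y \<le> exp (\<alpha>\<^sub>0 * v j) * f (x' j) y" "f (x' j) y \<le> exp (\<alpha>\<^sub>0 * v j) * f (x j) y" for y
            using f(4)[of "x j" "x' j" y] f(4)[of "x' j" "x j" y] F(4,5)[OF j] dj by auto
          show "q * f (x' j) y \<le> h j i y" "q * f (x j) y \<le> h j i y" if "i < m" for i y
            unfolding h_def by (intro clone hF[OF that] F(4,5)[OF j])+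
          show "integrable B (h j i)" "(\<integral>y. h j i y \<partial>B) = 1" if "i < m" for i
            unfolding h_def by (intro f(1) f1 hF[OF that])+
          show "0 \<le> \<alpha>\<^sub>0 * v j" using \<alpha>0 v0[OF j] by simp
        qed (use F(4,5)[OF j] f(1,2) f1 q L M M_def \<kappa>_def in auto)
        then show ?thesis unfolding upd(1)[symmetric] upd(2)[symmetric] using \<epsilon>(2)[OF j] tail False by simp
      qed
    qed
    have "Phi (h 0) \<le> exp (\<Sum>j<m. \<epsilon> j) * (Phi (h m) + (\<Sum>j<m. if v j \<noteq> 0 then \<delta> / k else 0))"
      using step \<epsilon>(1) \<delta> by (intro iterated_exp_bound) auto
    moreover have "(\<Sum>j<m. if v j \<noteq> 0 then \<delta> / k else 0) = (\<Sum>j\<in>V. \<delta> / k)"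
      using V by (intro sum.mono_neutral_cong_right) (auto simp: V_def)
    moreover have "\<dots> = \<delta>" using k by simp
    moreover have "Phi (h 0) = measure (Shuffle m N (independent_runs m A x)) S"
      by (subst runs) (use F(4) in \<open>auto simp: h_def intro!: Phi_cong\<close>)
    moreover have "Phi (h m) = measure (Shuffle m N (independent_runs m A x')) S"
      by (subst runs) (use F(5) in \<open>auto simp: h_def intro!: Phi_cong\<close>)
    ultimately show ?thesis by simp
  qed
  \<comment> \<open>Restricting to \<open>V\<close> before averaging gives the mean distance over
    the changed inputs only, and the factor \<open>norm0 m v\<close> in place of
    \<open>m\<close>.\<close>
  have "(\<Sum>i<m. \<epsilon> i) = (\<Sum>i\<in>V. \<epsilon> i)"
    using V by (intro sum.mono_neutral_right) (auto simp: V_def \<epsilon>_def)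
  also have "\<dots> \<le> real (card V) * ln (1 + (exp (\<alpha>\<^sub>0 * norm1 m v / k) - 1) / (exp (\<alpha>\<^sub>0 * norm1 m v / k) + 1) * \<kappa>)"
    unfolding \<epsilon>_def
  proof (rule sum_ln_tanh_le[OF V(1,2) _ \<kappa>0])
    show "0 \<le> \<alpha>\<^sub>0 * v i" if "i \<in> V" for i using that \<alpha>0 v0 by (auto simp: V_def)
    have "norm1 m v = (\<Sum>i\<in>V. v i)"
      unfolding norm1_def using V v0 by (intro sum.mono_neutral_cong_right) (auto simp: V_def)
    then show "\<alpha>\<^sub>0 * norm1 m v / k = (\<Sum>i\<in>V. \<alpha>\<^sub>0 * v i) / card V"
      by (simp add: k sum_distrib_left)
  qed
  finally have "(\<Sum>i<m. \<epsilon> i) \<le> real (norm0 m v) *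
        ln (1 + (exp (\<alpha>\<^sub>0 * norm1 m v / real (norm0 m v)) - 1)
                / (exp (\<alpha>\<^sub>0 * norm1 m v / real (norm0 m v)) + 1)
              * (8 * sqrt (exp \<alpha>\<^sub>0 * ln (4 * real (norm0 m v) / \<delta>)) / sqrt (real m)
                 + 8 * exp \<alpha>\<^sub>0 / real m))"
    unfolding k_def[symmetric] L_def[symmetric] \<kappa> k(1)[symmetric] .
  with main show ?thesis by (intro exI[of _ "\<Sum>i<m. \<epsilon> i"]) (auto simp: algebra_simps)
qed

end
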